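(* Let $n\geq 1$ and $N\geq 1$ be integers, and let $\underline{\rho}=(\rho_1,\dots,\rho_N)$ be an ordered collection of representations of $\mathfrak{gl}_n=\mathfrak{gl}_n(\mathbb{C})$ in which each $\rho_i$ is either a symmetric power $\mathrm{Sym}^{k_i}(\mathbb{C}^n)$ with $k_i\geq 1$, or an exterior power $\Lambda^{k_i}(\mathbb{C}^n)$ with $1\leq k_i\leq n$, of the standard (defining) representation $\mathbb{C}^n$ (symmetric and exterior powers may be mixed in the collection). Then the $\mathfrak{gl}_n$-weight system $W_{\underline{\rho}}:\mathscr{A}^{\rm h}_N\to\mathbb{C}$ is a quantum state, i.e. $W_{\underline{\rho}}(x\cdot x^\star)$ is a real number $\geq 0$ for every $x\in\mathscr{A}^{\rm h}_N$, and $W_{\underline{\rho}}(1)>0$.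
   Context: **$\star$-algebras and states.** A complex $\star$-algebra is a unital associative $\mathbb{C}$-algebra $\mathscr{O}$ with an involution $\star:\mathscr{O}\to\mathscr{O}$ such that $1^\star=1$, $(za+wb)^\star=\overline{z}a^\star+\overline{w}b^\star$ for $z,w\in\mathbb{C}$, and $(ab)^\star=b^\star a^\star$. A quantum state (or state) on $\mathscr{O}$ is a $\mathbb{C}$-linear map $\varphi:\mathscr{O}\to\mathbb{C}$ with $\varphi(x x^\star)\geq 0$ for all $x\in\mathscr{O}$ and $\varphi(1_{\mathscr{O}})>0$. **Horizontal chord diagrams.** Let $\mathscr{D}^{\rm h}_N$ be the free monoid (operation $\circ$) generated by the chords $(i,j)$, $1\leq i<j\leq N$; its neutral element is the chord-less diagram $\uparrow_N$. Write also $(j,i)=(i,j)$. The algebra of horizontal chord diagrams on $N$ strands is $\mathscr{A}^{\rm h}_N=\mathbb{C}[\mathscr{D}^{\rm h}_N]/I$, where $I$ is the two-sided ideal generated by the infinitesimal pure braid relations: $(i,j)\circ(k,l)-(k,l)\circ(i,j)$ for pairwise distinct $i,j,k,l$ (2T), and $(i,j)\circ(i,k)+(i,j)\circ(j,k)-(i,k)\circ(i,j)-(j,k)\circ(i,j)$ for pairwise distinct $i,j,k$ (4T). It is a complex $\star$-algebra with unit $\uparrow_N$ and with $\star$ the anti-linear extension of $[(i_1,j_1)\circ\cdots\circ(i_r,j_r)]^\star=(i_r,j_r)\circ\cdots\circ(i_1,j_1)$. **$\mathfrak{gl}_n$-weight systems.** Equip $\mathfrak{gl}_n$ with the bilinear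 form $\langle A,B\rangle=\mathrm{Tr}(AB)$ and let $e_1,\dots,e_{n^2}$ be an orthonormal basis of $\mathfrak{gl}_n$ for it. Given finite-dimensional representations $\rho_i:\mathfrak{gl}_n\to\mathrm{End}(V_i)$, $i=1,\dots,N$, let $\widetilde{W}_{\underline{\rho}}:\mathscr{A}^{\rm h}_N\to\mathrm{End}(V_1\otimes\cdots\otimes V_N)$ be the unital algebra homomorphism determined by $$\widetilde{W}_{\underline{\rho}}((i,j))=\sum_{r=1}^{n^2}\mathrm{Id}_{V_1}\otimes\cdots\otimes\rho_i(e_r)\otimes\cdots\otimes\rho_j(e_r)\otimes\cdots\otimes\mathrm{Id}_{V_N},$$ with $\rho_i(e_r)$ in the $i$-th position, $\rho_j(e_r)$ in the $j$-th position, and identities elsewhere (it is a standard fact that this is well defined and independent of the orthonormal basis). The weight system is $W_{\underline{\rho}}(x)=\mathrm{Tr}(\widetilde{W}_{\underline{\rho}}(x))$. *)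

theory Defs
  imports
    "HOL-Library.Poly_Mapping"
    "HOL-Algebra.QuotRing"
    "HOL-Combinatorics.Permutations"
    "Jordan_Normal_Form.VS_Connect"
begin

section \<open>Complex star-algebras and states\<close>

record 'b star_algebra = "(complex, 'b) module" +
  star :: "'b \<Rightarrow> 'b"  (\<open>\<star>\<index> _\<close> [81] 80)

locale complex_star_algebra =
  Module.module "class_ring :: complex ring" A + ring A
  for A :: "('b, 'm) star_algebra_scheme" (structure) +
  assumes smult_mult_left:
      "\<lbrakk>x \<in> carrier A; y \<in> carrier A\<rbrakk> \<Longrightarrow> (c \<odot> x) \<otimes> y = c \<odot> (x \<otimes> y)"
    and smult_mult_right:
      "\<lbrakk>x \<in> carrier A; y \<in> carrier A\<rbrakk> \<Longrightarrow> x \<otimes> (c \<odot> y) = c \<odot> (x \<otimes> y)"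
    and star_closed: "x \<in> carrier A \<Longrightarrow> \<star> x \<in> carrier A"
    and star_star: "x \<in> carrier A \<Longrightarrow> \<star> (\<star> x) = x"
    and star_one: "\<star> \<one> = \<one>"
    and star_antilinear: "\<lbrakk>x \<in> carrier A; y \<in> carrier A\<rbrakk> \<Longrightarrow>
      \<star> (z \<odot> x \<oplus> w \<odot> y) = cnj z \<odot> (\<star> x) \<oplus> cnj w \<odot> (\<star> y)"
    and star_mult: "\<lbrakk>x \<in> carrier A; y \<in> carrier A\<rbrakk> \<Longrightarrow> \<star> (x \<otimes> y) = (\<star> y) \<otimes> (\<star> x)"

locale quantum_state = complex_star_algebra A
  for A :: "('b, 'm) star_algebra_scheme" (structure) +
  fixes \<phi> :: "'b \<Rightarrow> complex"
  assumes state_linear: "\<lbrakk>x \<in> carrier A; y \<in> carrier A\<rbrakk> \<Longrightarrow>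
      \<phi> (z \<odot> x \<oplus> w \<odot> y) = z * \<phi> x + w * \<phi> y"
    and state_nonneg: "x \<in> carrier A \<Longrightarrow> \<phi> (x \<otimes> \<star> x) \<in> \<real> \<and> 0 \<le> Re (\<phi> (x \<otimes> \<star> x))"
    and state_one: "\<phi> \<one> \<in> \<real> \<and> 0 < Re (\<phi> \<one>)"


section \<open>Horizontal chord diagrams\<close>

text \<open>
  Words under concatenation, written additively because the convolution product of
  \<^type>\<open>poly_mapping\<close> is indexed by a \<^class>\<open>monoid_add\<close>: the (non-commutative) ring
  \<open>'a free_word \<Rightarrow>\<^sub>0 complex\<close> is then the monoid algebra of the free monoid.
\<close>

datatype 'a free_word = Word (letters: "'a list")

instantiation free_word :: (type) monoid_add
begin

definition "0 = Word []"

definition "u + v = Word (letters u @ letters v)"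

instance
  by standard (simp_all add: zero_free_word_def plus_free_word_def)

end

type_synonym chord = "nat \<times> nat"

type_synonym chord_combination = "chord free_word \<Rightarrow>\<^sub>0 complex"

definition chord_diagrams :: "nat \<Rightarrow> chord free_word set" where
  "chord_diagrams N = {w. set (letters w) \<subseteq> {(i, j). 1 \<le> i \<and> i < j \<and> j \<le> N}}"

definition scale :: "complex \<Rightarrow> chord_combination \<Rightarrow> chord_combination" where
  "scale c p = Poly_Mapping.map ((*) c) p"

definition reverse :: "chord_combination \<Rightarrow> chord_combination" where
  "reverse p =
    (\<Sum>w\<in>Poly_Mapping.keys p.
      Poly_Mapping.single (Word (rev (letters w))) (cnj (Poly_Mapping.lookup p w)))"

definition diagram_ring :: "nat \<Rightarrow> chord_combination ring" where
  "diagram_ring N =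
    \<lparr>carrier = {p. Poly_Mapping.keys p \<subseteq> chord_diagrams N},
     mult = (*), one = 1, zero = 0, add = (+)\<rparr>"

definition chord :: "nat \<Rightarrow> nat \<Rightarrow> chord_combination" where
  "chord i j = Poly_Mapping.single (Word [(min i j, max i j)]) 1"

definition relations_2T :: "nat \<Rightarrow> chord_combination set" where
  "relations_2T N =
    {chord i j * chord k l - chord k l * chord i j | i j k l.
      {i, j, k, l} \<subseteq> {1..N} \<and> distinct [i, j, k, l]}"

definition relations_4T :: "nat \<Rightarrow> chord_combination set" where
  "relations_4T N =
    {chord i j * chord i k + chord i j * chord j k - chord i k * chord i j - chord j k * chord i j
      | i j k. {i, j, k} \<subseteq> {1..N} \<and> distinct [i, j, k]}"

definition braid_ideal :: "nat \<Rightarrow> chord_combination set" where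
  "braid_ideal N = Idl\<^bsub>diagram_ring N\<^esub> (relations_2T N \<union> relations_4T N)"

text \<open>
  The elements of the quotient are cosets; scalar multiplication and star are induced from
  representatives in the same style as \<^const>\<open>rcoset_mult\<close>.
\<close>

definition hcd_algebra :: "nat \<Rightarrow> chord_combination set star_algebra" where
  "hcd_algebra N =
    (let R = diagram_ring N; I = braid_ideal N; Q = R Quot I in
      \<lparr>carrier = carrier Q, mult = mult Q, one = one Q, zero = zero Q, add = add Q,
       smult = (\<lambda>c X. \<Union>p\<in>X. I +>\<^bsub>R\<^esub> scale c p),
       star = (\<lambda>X. \<Union>p\<in>X. I +>\<^bsub>R\<^esub> reverse p)\<rparr>)"


section \<open>Representations of the general linear Lie algebra\<close>

definition mat_trace :: "complex mat \<Rightarrow> complex" where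
  "mat_trace A = (\<Sum>i<dim_row A. A $$ (i, i))"

definition gl_orthonormal_basis :: "nat \<Rightarrow> (nat \<Rightarrow> complex mat) \<Rightarrow> bool" where
  "gl_orthonormal_basis n e \<longleftrightarrow>
    (\<forall>r<n\<^sup>2. e r \<in> carrier_mat n n) \<and>
    (\<forall>r<n\<^sup>2. \<forall>s<n\<^sup>2. mat_trace (e r * e s) = (if r = s then 1 else 0)) \<and>
    (\<forall>A\<in>carrier_mat n n. \<exists>c. A = (\<Oplus>\<^bsub>module_mat TYPE(complex) n n\<^esub> r\<in>{..<n\<^sup>2}. c r \<cdot>\<^sub>m e r))"

definition gl_rep :: "nat \<Rightarrow> nat \<Rightarrow> (complex mat \<Rightarrow> complex mat) \<Rightarrow> bool" where
  "gl_rep n d \<rho> \<longleftrightarrow>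
    (\<forall>A\<in>carrier_mat n n. \<rho> A \<in> carrier_mat d d) \<and>
    (\<forall>A\<in>carrier_mat n n. \<forall>B\<in>carrier_mat n n. \<rho> (A + B) = \<rho> A + \<rho> B) \<and>
    (\<forall>c. \<forall>A\<in>carrier_mat n n. \<rho> (c \<cdot>\<^sub>m A) = c \<cdot>\<^sub>m \<rho> A) \<and>
    (\<forall>A\<in>carrier_mat n n. \<forall>B\<in>carrier_mat n n. \<rho> (A * B - B * A) = \<rho> A * \<rho> B - \<rho> B * \<rho> A)"

text \<open>
  An element \<open>t\<close> of the \<open>k\<close>-th tensor power of \<open>\<complex>\<^sup>n\<close> is given by its components with respect to the
  basis of pure tensors of standard basis vectors; \<open>t [x\<^sub>1, \<dots>, x\<^sub>k]\<close> is the coefficient of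
  \<open>e\<^bsub>x\<^sub>1\<^esub> \<otimes> \<dots> \<otimes> e\<^bsub>x\<^sub>k\<^esub>\<close>.  In characteristic zero, symmetric and exterior powers are the subspaces of
  symmetric and antisymmetric tensors.
\<close>

definition tensor_indices :: "nat \<Rightarrow> nat \<Rightarrow> nat list set" where
  "tensor_indices n k = {x. length x = k \<and> set x \<subseteq> {..<n}}"

definition tensor_power :: "nat \<Rightarrow> nat \<Rightarrow> (nat list \<Rightarrow> complex) set" where
  "tensor_power n k = {t. \<forall>x. x \<notin> tensor_indices n k \<longrightarrow> t x = 0}"

text \<open>\<open>\<Sum>\<^sub>j Id \<otimes> \<dots> \<otimes> A \<otimes> \<dots> \<otimes> Id\<close> with \<open>A\<close> in the \<open>j\<close>-th position\<close>

definition tensor_power_action ::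
  "nat \<Rightarrow> nat \<Rightarrow> complex mat \<Rightarrow> (nat list \<Rightarrow> complex) \<Rightarrow> nat list \<Rightarrow> complex" where
  "tensor_power_action n k A t x =
    (if x \<in> tensor_indices n k
     then \<Sum>j<k. \<Sum>m<n. A $$ (x ! j, m) * t (x[j := m])
     else 0)"

definition symmetric_tensors :: "nat \<Rightarrow> nat \<Rightarrow> (nat list \<Rightarrow> complex) set" where
  "symmetric_tensors n k =
    {t \<in> tensor_power n k. \<forall>\<sigma> x. \<sigma> permutes {..<k} \<and> x \<in> tensor_indices n k \<longrightarrow>
      t (permute_list \<sigma> x) = t x}"

definition antisymmetric_tensors :: "nat \<Rightarrow> nat \<Rightarrow> (nat list \<Rightarrow> complex) set" where
  "antisymmetric_tensors n k =
    {t \<in> tensor_power n k. \<forall>\<sigma> x. \<sigma> permutes {..<k} \<and> x \<in> tensor_indices n k \<longrightarrow>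
      t (permute_list \<sigma> x) = of_int (sign \<sigma>) * t x}"

text \<open>
  \<open>\<rho>\<close> on \<open>\<complex>\<^sup>d\<close> is isomorphic to the subrepresentation \<open>V\<close> of the \<open>k\<close>-th tensor power of \<open>\<complex>\<^sup>n\<close>,
  that is, \<open>\<rho>\<close> is \<open>V\<close> written in some basis.
\<close>

definition isomorphic_to_subrep ::
  "nat \<Rightarrow> nat \<Rightarrow> (nat list \<Rightarrow> complex) set \<Rightarrow> nat \<Rightarrow> (complex mat \<Rightarrow> complex mat) \<Rightarrow> bool" where
  "isomorphic_to_subrep n k V d \<rho> \<longleftrightarrow>
    (\<exists>f. bij_betw f (carrier_vec d) V \<and>
      (\<forall>v\<in>carrier_vec d. \<forall>w\<in>carrier_vec d. f (v + w) = (\<lambda>x. f v x + f w x)) \<and>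
      (\<forall>c. \<forall>v\<in>carrier_vec d. f (c \<cdot>\<^sub>v v) = (\<lambda>x. c * f v x)) \<and>
      (\<forall>A\<in>carrier_mat n n. \<forall>v\<in>carrier_vec d.
        f (\<rho> A *\<^sub>v v) = tensor_power_action n k A (f v)))"

definition is_symmetric_power ::
  "nat \<Rightarrow> nat \<Rightarrow> nat \<Rightarrow> (complex mat \<Rightarrow> complex mat) \<Rightarrow> bool" where
  "is_symmetric_power n k d \<rho> \<longleftrightarrow>
    gl_rep n d \<rho> \<and> isomorphic_to_subrep n k (symmetric_tensors n k) d \<rho>"

definition is_exterior_power ::
  "nat \<Rightarrow> nat \<Rightarrow> nat \<Rightarrow> (complex mat \<Rightarrow> complex mat) \<Rightarrow> bool" where
  "is_exterior_power n k d \<rho> \<longleftrightarrow>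
    gl_rep n d \<rho> \<and> isomorphic_to_subrep n k (antisymmetric_tensors n k) d \<rho>"


section \<open>Weight systems\<close>

definition kronecker :: "complex mat \<Rightarrow> complex mat \<Rightarrow> complex mat" where
  "kronecker A B =
    mat (dim_row A * dim_row B) (dim_col A * dim_col B)
      (\<lambda>(i, j). A $$ (i div dim_row B, j div dim_col B) * B $$ (i mod dim_row B, j mod dim_col B))"

definition tensor_mats :: "complex mat list \<Rightarrow> complex mat" where
  "tensor_mats As = foldr kronecker As (1\<^sub>m 1)"

text \<open>
  In the following, \<open>\<rho> i\<close> is a representation on \<open>\<complex>\<^bsup>d i\<^esup>\<close> for each strand \<open>i \<in> {1..N}\<close>, and
  endomorphisms of the tensor product of these spaces are matrices of size \<open>tensor_dim N d\<close>.
\<close>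

definition tensor_dim :: "nat \<Rightarrow> (nat \<Rightarrow> nat) \<Rightarrow> nat" where
  "tensor_dim N d = (\<Prod>i\<in>{1..N}. d i)"

definition chord_operator ::
  "nat \<Rightarrow> nat \<Rightarrow> (nat \<Rightarrow> complex mat) \<Rightarrow> (nat \<Rightarrow> nat) \<Rightarrow> (nat \<Rightarrow> complex mat \<Rightarrow> complex mat)
    \<Rightarrow> chord \<Rightarrow> complex mat" where
  "chord_operator n N e d \<rho> = (\<lambda>(i, j).
    \<Oplus>\<^bsub>module_mat TYPE(complex) (tensor_dim N d) (tensor_dim N d)\<^esub> r\<in>{..<n\<^sup>2}.
      tensor_mats (map (\<lambda>l. if l = i \<or> l = j then \<rho> l (e r) else 1\<^sub>m (d l)) [1..<N + 1]))"

definition diagram_operator ::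
  "nat \<Rightarrow> nat \<Rightarrow> (nat \<Rightarrow> complex mat) \<Rightarrow> (nat \<Rightarrow> nat) \<Rightarrow> (nat \<Rightarrow> complex mat \<Rightarrow> complex mat)
    \<Rightarrow> chord free_word \<Rightarrow> complex mat" where
  "diagram_operator n N e d \<rho> w =
    foldr (\<lambda>c M. chord_operator n N e d \<rho> c * M) (letters w) (1\<^sub>m (tensor_dim N d))"

definition combination_operator ::
  "nat \<Rightarrow> nat \<Rightarrow> (nat \<Rightarrow> complex mat) \<Rightarrow> (nat \<Rightarrow> nat) \<Rightarrow> (nat \<Rightarrow> complex mat \<Rightarrow> complex mat)
    \<Rightarrow> chord_combination \<Rightarrow> complex mat" where
  "combination_operator n N e d \<rho> p =
    (\<Oplus>\<^bsub>module_mat TYPE(complex) (tensor_dim N d) (tensor_dim N d)\<^esub> w\<in>Poly_Mapping.keys p.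
      Poly_Mapping.lookup p w \<cdot>\<^sub>m diagram_operator n N e d \<rho> w)"

text \<open>
  The operator and the weight of an element of the quotient, i.e. of a coset; when \<open>\<rho>\<close> consists of
  representations and \<open>e\<close> is an orthonormal basis, all members of the coset have the same operator.
\<close>

definition operator_weight_system ::
  "nat \<Rightarrow> nat \<Rightarrow> (nat \<Rightarrow> complex mat) \<Rightarrow> (nat \<Rightarrow> nat) \<Rightarrow> (nat \<Rightarrow> complex mat \<Rightarrow> complex mat)
    \<Rightarrow> chord_combination set \<Rightarrow> complex mat" where
  "operator_weight_system n N e d \<rho> X = the_elem (combination_operator n N e d \<rho> ` X)"

definition weight_system ::
  "nat \<Rightarrow> nat \<Rightarrow> (nat \<Rightarrow> complex mat) \<Rightarrow> (nat \<Rightarrow> nat) \<Rightarrow> (nat \<Rightarrow> complex mat \<Rightarrow> complex mat)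
    \<Rightarrow> chord_combination set \<Rightarrow> complex" where
  "weight_system n N e d \<rho> X = mat_trace (operator_weight_system n N e d \<rho> X)"

end

theory Submission
  imports Defs
begin

text \<open>
  The conjugate transposes of an orthonormal basis for the trace form are again an orthonormal
  basis, so the Casimir element \<open>\<Sum>\<^sub>r e\<^sub>r \<otimes> e\<^sub>r\<close> may be computed with either.  For the inner product
  that a symmetric or exterior power inherits from the tensor power of \<open>\<complex>\<^sup>n\<close>, the adjoint of
  \<open>\<rho> A\<close> is \<open>\<rho>\<close> of the conjugate transpose of \<open>A\<close>.  Hence every chord acts on the tensor product of
  the strands by a self-adjoint operator, reversal of diagrams becomes the operator adjoint, and
  the weight of \<open>x x\<^sup>\<star>\<close> is a trace \<open>Tr (M M\<^sup>*) \<ge> 0\<close>.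
\<close>

text \<open>The matrices \<open>e r\<close> are orthonormal for the complex bilinear trace form, so
  they need not be Hermitian, and the single summands of a chord operator need not be self-adjoint;
  only the sum over the whole basis is. A second obstacle is that \<open>is_symmetric_power\<close>
  and \<open>is_exterior_power\<close> present the representation in an arbitrary basis of the
  coordinate space, where the adjoint for the inherited inner product is in general not the
  conjugate transpose. The inner product is therefore carried along as a Gram matrix
  \<open>G = adj F * F\<close>, with \<open>F\<close> the rectangular matrix of the embedding into
  the tensor power, and self-adjointness of an operator \<open>C\<close> reads
  \<open>G * C = adj C * G\<close>. No orthonormal basis is chosen: \<open>F\<close> itself serves
  as a square root of \<open>G\<close> in the final trace. Independently, the weight must make sense
  on cosets: the operators have to kill the braid relations, which is the invariance of the Casimir
  element, and reversal has to preserve the ideal. Strict positivity at the unit is the separate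
  claim that none of the spaces vanishes; this is where \<open>k i \<le> n\<close> enters for
  exterior powers.\<close>

section \<open>The star algebra of horizontal chord diagrams\<close>

text \<open>Updating at a fresh key is adding a monomial, so additive claims about combinations
  reduce to monomials. The step asks for no freshness of \<open>k\<close>, so distributivity alone
  can discharge it.\<close>

lemma poly_mapping_single_induct [case_names zero add_single]:
  fixes p :: "'a \<Rightarrow>\<^sub>0 'b::monoid_add"
  assumes "P 0" and "\<And>p k v. P p \<Longrightarrow> P (p + Poly_Mapping.single k v)"
  shows "P p"
proof (induction p rule: update_induct)
  case (update p k v)
  have "Poly_Mapping.update k v p = p + Poly_Mapping.single k v"
    using update(1) by (intro poly_mapping_eqI)
      (auto simp: lookup_update lookup_add lookup_single in_keys_iff when_def)
  then show ?case using assms(2) update by simp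
qed (rule assms(1))

lemma lookup_scale: "Poly_Mapping.lookup (scale c p) w = c * Poly_Mapping.lookup p w"
  unfolding scale_def by (simp add: Poly_Mapping.map.rep_eq when_def)

lemma scale_eq_mult: "scale c p = Poly_Mapping.single 0 c * p"
  unfolding scale_def by (rule mult_map_scale_conv_mult)

lemma scale_mult_left: "scale c p * q = scale c (p * q)"
  by (simp add: scale_eq_mult mult.assoc)

lemma scale_add: "scale c (p + q) = scale c p + scale c q"
  by (rule poly_mapping_eqI) (simp add: lookup_scale lookup_add algebra_simps)

lemma scale_diff: "scale c (p - q) = scale c p - scale c q"
  by (rule poly_mapping_eqI) (simp add: lookup_scale lookup_minus algebra_simps)

text \<open>Constants sit at the empty word \<open>0\<close>, which commutes with every word; hence
  they are central although the convolution product is not commutative.\<close>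

lemma scale_mult_right: "p * scale c q = scale c (p * q)"
proof (induction p rule: poly_mapping_single_induct)
  case (add_single p k v)
  have "Poly_Mapping.single k v * (Poly_Mapping.single 0 c * q)
      = Poly_Mapping.single 0 c * (Poly_Mapping.single k v * q)"
    by (simp add: mult.assoc[symmetric] mult_single mult.commute)
  then show ?case using add_single
    by (simp add: scale_eq_mult distrib_left distrib_right)
qed (simp add: scale_eq_mult)

definition reverse_word :: "'a free_word \<Rightarrow> 'a free_word" where
  "reverse_word w = Word (rev (letters w))"

lemma reverse_word_reverse_word [simp]: "reverse_word (reverse_word w) = w"
  by (simp add: reverse_word_def)

lemma reverse_word_eq_iff: "reverse_word v = w \<longleftrightarrow> v = reverse_word w"
  by auto

lemma reverse_word_add: "reverse_word (v + w) = reverse_word w + reverse_word v"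
  by (simp add: reverse_word_def plus_free_word_def)

text \<open>Reversal is an involution on words, so the sum defining \<open>reverse\<close> has at
  most one contribution at each word. The coefficientwise form turns the antilinearity laws into
  identities between complex numbers.\<close>

lemma lookup_reverse: "Poly_Mapping.lookup (reverse p) w = cnj (Poly_Mapping.lookup p (reverse_word w))"
proof -
  have "Poly_Mapping.lookup (reverse p) w
      = (\<Sum>v\<in>Poly_Mapping.keys p. if v = reverse_word w then cnj (Poly_Mapping.lookup p v) else 0)"
    unfolding reverse_def reverse_word_def[symmetric]
    by (auto simp: lookup_sum lookup_single when_def reverse_word_eq_iff intro!: sum.cong)
  also have "\<dots> = cnj (Poly_Mapping.lookup p (reverse_word w))"
    by (simp add: in_keys_iff)
  finally show ?thesis .
qed

lemma reverse_reverse: "reverse (reverse p) = p"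
  by (rule poly_mapping_eqI) (simp add: lookup_reverse)

lemma reverse_zero [simp]: "reverse 0 = 0"
  by (rule poly_mapping_eqI) (simp add: lookup_reverse)

lemma reverse_add: "reverse (p + q) = reverse p + reverse q"
  by (rule poly_mapping_eqI) (simp add: lookup_reverse lookup_add)

lemma reverse_diff: "reverse (p - q) = reverse p - reverse q"
  by (rule poly_mapping_eqI) (simp add: lookup_reverse lookup_minus)

lemma reverse_scale: "reverse (scale c p) = scale (cnj c) (reverse p)"
  by (rule poly_mapping_eqI) (simp add: lookup_reverse lookup_scale)

lemma reverse_single: "reverse (Poly_Mapping.single w c) = Poly_Mapping.single (reverse_word w) (cnj c)"
  by (rule poly_mapping_eqI) (auto simp: lookup_reverse lookup_single when_def)

lemma reverse_one: "reverse 1 = 1"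
  unfolding single_one[symmetric] reverse_single
  by (simp add: reverse_word_def zero_free_word_def)

text \<open>Both sides are biadditive, so two nested inductions reduce the claim to monomials, where
  it is \<open>reverse_word_add\<close>.\<close>

lemma reverse_mult: "reverse (p * q) = reverse q * reverse p"
proof (induction p rule: poly_mapping_single_induct)
  case (add_single p k v)
  have "reverse (Poly_Mapping.single k v * q) = reverse q * reverse (Poly_Mapping.single k v)"
  proof (induction q rule: poly_mapping_single_induct)
    case (add_single q l u)
    then show ?case
      by (simp add: distrib_left distrib_right reverse_add reverse_single mult_single
          reverse_word_add mult.commute)
  qed simp
  then show ?case using add_single by (simp add: distrib_left distrib_right reverse_add)
qed simp

lemma reverse_chord: "reverse (chord i j) = chord i j"
  by (simp add: chord_def reverse_single reverse_word_def)


section \<open>The ring of chord combinations and its ideal of braid relations\<close>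

lemma diagram_ring_simps [simp]:
  "carrier (diagram_ring N) = {p. Poly_Mapping.keys p \<subseteq> chord_diagrams N}"
  "mult (diagram_ring N) = (*)" "one (diagram_ring N) = 1"
  "zero (diagram_ring N) = 0" "add (diagram_ring N) = (+)"
  by (simp_all add: diagram_ring_def)

lemma zero_in_chord_diagrams: "0 \<in> chord_diagrams N"
  by (simp add: chord_diagrams_def zero_free_word_def)

lemma add_in_chord_diagrams:
  "v \<in> chord_diagrams N \<Longrightarrow> w \<in> chord_diagrams N \<Longrightarrow> v + w \<in> chord_diagrams N"
  by (auto simp: chord_diagrams_def plus_free_word_def)

lemma reverse_word_in_chord_diagrams:
  "reverse_word w \<in> chord_diagrams N \<longleftrightarrow> w \<in> chord_diagrams N"
  by (simp add: chord_diagrams_def reverse_word_def)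

lemma keys_scale: "Poly_Mapping.keys (scale c p) \<subseteq> Poly_Mapping.keys p"
  by (auto simp: in_keys_iff lookup_scale)

lemma keys_reverse: "Poly_Mapping.keys (reverse p) = reverse_word ` Poly_Mapping.keys p"
proof -
  have "w \<in> reverse_word ` Poly_Mapping.keys p" if "reverse_word w \<in> Poly_Mapping.keys p" for w
    using imageI[OF that, of reverse_word] by simp
  then show ?thesis by (auto simp: in_keys_iff lookup_reverse)
qed

lemma reverse_in_diagram_ring:
  "p \<in> carrier (diagram_ring N) \<Longrightarrow> reverse p \<in> carrier (diagram_ring N)"
  by (auto simp: keys_reverse reverse_word_in_chord_diagrams)

lemma keys_uminus: "Poly_Mapping.keys (- p :: 'a \<Rightarrow>\<^sub>0 'b::ab_group_add) = Poly_Mapping.keys p"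
  by (auto simp: in_keys_iff)

lemma ring_diagram_ring: "ring (diagram_ring N)"
proof (rule ringI)
  show "abelian_group (diagram_ring N)"
  proof (rule abelian_groupI)
    fix p assume "p \<in> carrier (diagram_ring N)"
    then show "\<exists>q\<in>carrier (diagram_ring N). q \<oplus>\<^bsub>diagram_ring N\<^esub> p = \<zero>\<^bsub>diagram_ring N\<^esub>"
      by (intro bexI[of _ "- p"]) (auto simp: keys_uminus)
  qed (auto simp: algebra_simps dest!: subsetD[OF keys_add])
  show "monoid (diagram_ring N)"
    by (rule monoidI)
      (auto simp: algebra_simps zero_in_chord_diagrams dest!: subsetD[OF keys_mult]
        intro!: add_in_chord_diagrams)
qed (auto simp: algebra_simps)

lemma chord_in_diagram_ring:
  assumes "i \<in> {1..N}" "j \<in> {1..N}" "i \<noteq> j"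
  shows "chord i j \<in> carrier (diagram_ring N)"
  using assms by (auto simp: chord_def chord_diagrams_def)

lemma minus_in_diagram_ring:
  assumes "p \<in> carrier (diagram_ring N)" "q \<in> carrier (diagram_ring N)"
  shows "p - q \<in> carrier (diagram_ring N)"
proof -
  have "Poly_Mapping.keys (p - q) \<subseteq> Poly_Mapping.keys p \<union> Poly_Mapping.keys q"
    by (auto simp: in_keys_iff lookup_minus)
  then show ?thesis using assms by auto
qed

lemma relations_subset_carrier: "relations_2T N \<union> relations_4T N \<subseteq> carrier (diagram_ring N)"
proof -
  interpret ring "diagram_ring N" by (rule ring_diagram_ring)
  note closed = minus_in_diagram_ring a_closed[simplified diagram_ring_simps(5)]
    m_closed[simplified diagram_ring_simps(2)] chord_in_diagram_ring
  have "p \<in> carrier (diagram_ring N)" if "p \<in> relations_2T N" for p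
    using that unfolding relations_2T_def by (auto simp del: diagram_ring_simps intro!: closed)
  moreover have "p \<in> carrier (diagram_ring N)" if "p \<in> relations_4T N" for p
    using that unfolding relations_4T_def by (auto simp del: diagram_ring_simps intro!: closed)
  ultimately show ?thesis by blast
qed

lemma ideal_braid_ideal: "ideal (braid_ideal N) (diagram_ring N)"
  unfolding braid_ideal_def
  by (rule ring.genideal_ideal[OF ring_diagram_ring relations_subset_carrier])

lemma relations_subset_braid_ideal: "relations_2T N \<union> relations_4T N \<subseteq> braid_ideal N"
  unfolding braid_ideal_def
  by (rule ring.genideal_self[OF ring_diagram_ring relations_subset_carrier])

text \<open>This serves as the induction principle for the ideal: a property of its members follows
  once the elements with that property are seen to form an ideal containing both families of
  relations.\<close>

lemma braid_ideal_least:
  assumes "ideal J (diagram_ring N)" "relations_2T N \<subseteq> J" "relations_4T N \<subseteq> J"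
  shows "braid_ideal N \<subseteq> J"
  unfolding braid_ideal_def using assms
  by (intro ring.genideal_minimal[OF ring_diagram_ring]) auto

lemma a_inv_diagram_ring:
  assumes "p \<in> carrier (diagram_ring N)"
  shows "\<ominus>\<^bsub>diagram_ring N\<^esub> p = - p"
proof -
  interpret ring "diagram_ring N" by (rule ring_diagram_ring)
  show ?thesis using assms minus_equality[of "- p" p] by (simp add: keys_uminus)
qed

lemma ideal_diagram_ringI:
  assumes "J \<subseteq> carrier (diagram_ring N)" "0 \<in> J"
    and "\<And>p q. p \<in> J \<Longrightarrow> q \<in> J \<Longrightarrow> p + q \<in> J" "\<And>p. p \<in> J \<Longrightarrow> - p \<in> J"
    and "\<And>p x. p \<in> J \<Longrightarrow> x \<in> carrier (diagram_ring N) \<Longrightarrow> x * p \<in> J"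
    and "\<And>p x. p \<in> J \<Longrightarrow> x \<in> carrier (diagram_ring N) \<Longrightarrow> p * x \<in> J"
  shows "ideal J (diagram_ring N)"
proof (rule idealI[OF ring_diagram_ring])
  interpret ring "diagram_ring N" by (rule ring_diagram_ring)
  show "subgroup J (add_monoid (diagram_ring N))"
  proof (rule add.subgroupI)
    fix p assume "p \<in> J"
    then show "\<ominus>\<^bsub>diagram_ring N\<^esub> p \<in> J"
      using assms a_inv_diagram_ring[of p N] by auto
  qed (use assms in auto)
qed (use assms in auto)

lemma braid_ideal_closed:
  shows "p \<in> braid_ideal N \<Longrightarrow> p \<in> carrier (diagram_ring N)"
    and "0 \<in> braid_ideal N"
    and "p \<in> braid_ideal N \<Longrightarrow> q \<in> braid_ideal N \<Longrightarrow> p + q \<in> braid_ideal N"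
    and "p \<in> braid_ideal N \<Longrightarrow> - p \<in> braid_ideal N"
    and "p \<in> braid_ideal N \<Longrightarrow> x \<in> carrier (diagram_ring N) \<Longrightarrow> x * p \<in> braid_ideal N"
    and "p \<in> braid_ideal N \<Longrightarrow> x \<in> carrier (diagram_ring N) \<Longrightarrow> p * x \<in> braid_ideal N"
proof -
  interpret ideal "braid_ideal N" "diagram_ring N" by (rule ideal_braid_ideal)
  show car: "p \<in> braid_ideal N \<Longrightarrow> p \<in> carrier (diagram_ring N)" for p by (rule Icarr)
  show "0 \<in> braid_ideal N"
    and "p \<in> braid_ideal N \<Longrightarrow> q \<in> braid_ideal N \<Longrightarrow> p + q \<in> braid_ideal N"
    using additive_subgroup.zero_closed[OF is_additive_subgroup]
      additive_subgroup.a_closed[OF is_additive_subgroup] by simp_all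
  show "p \<in> braid_ideal N \<Longrightarrow> - p \<in> braid_ideal N"
    using additive_subgroup.a_inv_closed[OF is_additive_subgroup, of p] a_inv_diagram_ring[OF car] by simp
  show "p \<in> braid_ideal N \<Longrightarrow> x \<in> carrier (diagram_ring N) \<Longrightarrow> x * p \<in> braid_ideal N"
    and "p \<in> braid_ideal N \<Longrightarrow> x \<in> carrier (diagram_ring N) \<Longrightarrow> p * x \<in> braid_ideal N"
    using I_l_closed I_r_closed by simp_all
qed

lemma scale_in_diagram_ring:
  "p \<in> carrier (diagram_ring N) \<Longrightarrow> scale c p \<in> carrier (diagram_ring N)"
  using keys_scale[of c p] by auto

text \<open>The ideal is generated in the ring sense only; it is a complex subspace because scaling
  is multiplication by a ring element concentrated at the empty word.\<close>

lemma scale_in_braid_ideal: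
  assumes "p \<in> braid_ideal N"
  shows "scale c p \<in> braid_ideal N"
  unfolding scale_eq_mult
  by (rule braid_ideal_closed(5)[OF assms]) (auto simp: zero_in_chord_diagrams)

text \<open>Reversal exchanges left and right multiples, so the preimage of the ideal under it is
  again a two-sided ideal. A 2T relation reverses to the 2T relation with the two chords exchanged,
  and a 4T relation to its own negative.\<close>

lemma reverse_in_braid_ideal:
  assumes "p \<in> braid_ideal N"
  shows "reverse p \<in> braid_ideal N"
proof -
  let ?J = "{p \<in> carrier (diagram_ring N). reverse p \<in> braid_ideal N}"
  interpret ring "diagram_ring N" by (rule ring_diagram_ring)
  note closed = a_closed[simplified diagram_ring_simps(5)] m_closed[simplified diagram_ring_simps(2)]
  have neg: "- p \<in> carrier (diagram_ring N)" if "p \<in> carrier (diagram_ring N)" for p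
    using that by (simp add: keys_uminus)
  have "ideal ?J (diagram_ring N)"
  proof (rule ideal_diagram_ringI)
    fix p assume p: "p \<in> ?J"
    have "reverse (- p) = - reverse p" using reverse_diff[of 0 p] by simp
    then show "- p \<in> ?J" using p neg braid_ideal_closed(4) by simp
  next
    fix p x assume "p \<in> ?J" "x \<in> carrier (diagram_ring N)"
    then show "x * p \<in> ?J" "p * x \<in> ?J"
      using closed reverse_in_diagram_ring braid_ideal_closed(5,6)
      by (simp_all add: reverse_mult del: diagram_ring_simps)
  next
    show "0 \<in> ?J" by (simp add: braid_ideal_closed(2))
  qed (auto simp: reverse_add braid_ideal_closed(3) closed simp del: diagram_ring_simps)
  moreover have "relations_2T N \<subseteq> ?J"
  proof
    fix p assume p: "p \<in> relations_2T N"
    have "reverse p \<in> relations_2T N"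
      using p unfolding relations_2T_def
      by (auto simp: reverse_diff reverse_mult reverse_chord) metis
    then show "p \<in> ?J" using p relations_subset_carrier[of N] relations_subset_braid_ideal[of N]
      by blast
  qed
  moreover have "relations_4T N \<subseteq> ?J"
  proof
    fix p assume p: "p \<in> relations_4T N"
    then have "reverse p = - p" unfolding relations_4T_def
      by (auto simp: reverse_diff reverse_mult reverse_add reverse_chord)
    moreover have "- p \<in> braid_ideal N"
      using p relations_subset_braid_ideal[of N] by (intro braid_ideal_closed(4)) auto
    ultimately show "p \<in> ?J" using p relations_subset_carrier[of N] by auto
  qed
  ultimately show ?thesis using braid_ideal_least[of ?J N] assms by blast
qed

section \<open>Cosets of the ideal and the operations induced on them\<close>

abbreviation braid_coset :: "nat \<Rightarrow> chord_combination \<Rightarrow> chord_combination set" where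
  "braid_coset N p \<equiv> braid_ideal N +>\<^bsub>diagram_ring N\<^esub> p"

lemma braid_coset_def: "braid_coset N p = {q + p | q. q \<in> braid_ideal N}"
  by (auto simp: a_r_coset_def r_coset_def)

lemma mem_braid_coset: "q \<in> braid_coset N p \<longleftrightarrow> q - p \<in> braid_ideal N"
  by (auto simp: braid_coset_def) (metis diff_add_cancel)

lemma braid_coset_eqI:
  assumes "q - p \<in> braid_ideal N"
  shows "braid_coset N q = braid_coset N p"
proof -
  have "r - q \<in> braid_ideal N \<longleftrightarrow> r - p \<in> braid_ideal N" for r
    using braid_ideal_closed(3)[of "r - q" N "q - p"] assms
      braid_ideal_closed(3)[of "r - p" N "- (q - p)"] braid_ideal_closed(4)[OF assms]
    by (auto simp: algebra_simps)
  then show ?thesis by (auto simp: mem_braid_coset)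
qed

lemma carrier_hcd_algebra: "carrier (hcd_algebra N) = braid_coset N ` carrier (diagram_ring N)"
  by (auto simp: hcd_algebra_def Let_def FactRing_def A_RCOSETS_def' simp del: diagram_ring_simps)

lemma one_hcd_algebra: "one (hcd_algebra N) = braid_coset N 1"
  by (simp add: hcd_algebra_def Let_def FactRing_def)

lemma zero_hcd_algebra: "zero (hcd_algebra N) = braid_coset N 0"
  by (simp add: hcd_algebra_def Let_def FactRing_def braid_coset_def)

lemma add_hcd_algebra:
  assumes "p \<in> carrier (diagram_ring N)" "q \<in> carrier (diagram_ring N)"
  shows "add (hcd_algebra N) (braid_coset N p) (braid_coset N q) = braid_coset N (p + q)"
  using ideal.a_rcos_sum[OF ideal_braid_ideal assms]
  by (simp add: hcd_algebra_def Let_def FactRing_def)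

lemma mult_hcd_algebra:
  assumes "p \<in> carrier (diagram_ring N)" "q \<in> carrier (diagram_ring N)"
  shows "mult (hcd_algebra N) (braid_coset N p) (braid_coset N q) = braid_coset N (p * q)"
  using ideal.rcoset_mult_add[OF ideal_braid_ideal assms]
  by (simp add: hcd_algebra_def Let_def FactRing_def)

text \<open>The union in the definition runs over all representatives. They scale into a single
  coset because the ideal is closed under \<open>scale\<close>, and \<open>p\<close> itself shows
  that the union is not empty.\<close>

lemma smult_hcd_algebra:
  "smult (hcd_algebra N) c (braid_coset N p) = braid_coset N (scale c p)"
proof -
  have "(\<Union>q\<in>braid_coset N p. braid_coset N (scale c q)) = (\<Union>q\<in>braid_coset N p. braid_coset N (scale c p))"
    by (intro SUP_cong refl braid_coset_eqI)
      (auto simp: mem_braid_coset scale_diff[symmetric] intro: scale_in_braid_ideal)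
  moreover have "p \<in> braid_coset N p" by (simp add: mem_braid_coset braid_ideal_closed(2))
  ultimately show ?thesis by (auto simp: hcd_algebra_def Let_def)
qed

lemma star_hcd_algebra: "star (hcd_algebra N) (braid_coset N p) = braid_coset N (reverse p)"
proof -
  have "(\<Union>q\<in>braid_coset N p. braid_coset N (reverse q)) = (\<Union>q\<in>braid_coset N p. braid_coset N (reverse p))"
    by (intro SUP_cong refl braid_coset_eqI)
      (auto simp: mem_braid_coset reverse_diff[symmetric] intro: reverse_in_braid_ideal)
  moreover have "p \<in> braid_coset N p" by (simp add: mem_braid_coset braid_ideal_closed(2))
  ultimately show ?thesis by (auto simp: hcd_algebra_def Let_def)
qed

text \<open>Every member of the carrier is a \<open>braid_coset\<close> and each operation is
  computed on representatives, so each axiom descends from the same identity in the monoid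
  algebra.\<close>

lemma complex_star_algebra_hcd_algebra: "complex_star_algebra (hcd_algebra N)"
proof -
  interpret D: ring "diagram_ring N" by (rule ring_diagram_ring)
  note D_closed = D.a_closed[simplified diagram_ring_simps(5)]
    D.m_closed[simplified diagram_ring_simps(2)] scale_in_diagram_ring
    D.one_closed[simplified diagram_ring_simps(3)] D.zero_closed[simplified diagram_ring_simps(4)]
    reverse_in_diagram_ring
  note ops = carrier_hcd_algebra one_hcd_algebra zero_hcd_algebra add_hcd_algebra mult_hcd_algebra
    smult_hcd_algebra star_hcd_algebra
  have ab: "abelian_group (hcd_algebra N)"
  proof (rule abelian_groupI)
    fix X assume "X \<in> carrier (hcd_algebra N)"
    then obtain p where p: "p \<in> carrier (diagram_ring N)" "X = braid_coset N p"
      by (auto simp: carrier_hcd_algebra simp del: diagram_ring_simps)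
    moreover have "- p \<in> carrier (diagram_ring N)" using p by (simp add: keys_uminus)
    ultimately show "\<exists>Y\<in>carrier (hcd_algebra N). Y \<oplus>\<^bsub>hcd_algebra N\<^esub> X = \<zero>\<^bsub>hcd_algebra N\<^esub>"
      by (intro bexI[of _ "braid_coset N (- p)"])
        (auto simp: ops simp del: diagram_ring_simps)
  qed (auto simp: ops D_closed algebra_simps simp del: diagram_ring_simps intro!: imageI)
  have ring: "ring (hcd_algebra N)"
  proof (rule ringI[OF ab])
    show "monoid (hcd_algebra N)"
      by (rule monoidI) (auto simp: ops D_closed algebra_simps simp del: diagram_ring_simps intro!: imageI)
  qed (auto simp: ops D_closed algebra_simps simp del: diagram_ring_simps)
  have "cring (class_ring :: complex ring)"
    using class_field.field_axioms[where 'a = complex] by (auto simp: field_def domain_def)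
  then have "Module.module (class_ring :: complex ring) (hcd_algebra N)"
  proof (rule moduleI[OF _ ab])
    fix a b :: complex and X assume "X \<in> carrier (hcd_algebra N)"
    then obtain p where p: "p \<in> carrier (diagram_ring N)" "X = braid_coset N p"
      by (auto simp: carrier_hcd_algebra simp del: diagram_ring_simps)
    have "scale (a + b) p = scale a p + scale b p" "scale (a * b) p = scale a (scale b p)"
      "scale 1 p = p"
      by (auto intro!: poly_mapping_eqI simp: lookup_scale lookup_add algebra_simps)
    then show "(a \<oplus>\<^bsub>class_ring\<^esub> b) \<odot>\<^bsub>hcd_algebra N\<^esub> X
          = a \<odot>\<^bsub>hcd_algebra N\<^esub> X \<oplus>\<^bsub>hcd_algebra N\<^esub> b \<odot>\<^bsub>hcd_algebra N\<^esub> X"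
      "(a \<otimes>\<^bsub>class_ring\<^esub> b) \<odot>\<^bsub>hcd_algebra N\<^esub> X
          = a \<odot>\<^bsub>hcd_algebra N\<^esub> (b \<odot>\<^bsub>hcd_algebra N\<^esub> X)"
      "\<one>\<^bsub>class_ring\<^esub> \<odot>\<^bsub>hcd_algebra N\<^esub> X = X"
      using p by (auto simp: ops D_closed simp del: diagram_ring_simps)
  qed (auto simp: ops D_closed scale_add simp del: diagram_ring_simps intro!: imageI)
  then show ?thesis
    by (intro complex_star_algebra.intro ring complex_star_algebra_axioms.intro)
      (auto simp: ops D_closed scale_mult_left scale_mult_right reverse_one reverse_reverse reverse_add
        reverse_scale reverse_mult simp del: diagram_ring_simps intro!: imageI)
qed

section \<open>Matrices\<close>

text \<open>Entrywise form of \<open>finsum\<close> in \<open>module_mat\<close>, with the size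
  fixed by \<open>m\<close> so that the empty sum is a zero matrix. Exchanging matrix sums with
  products and adjoints becomes a matter of sums of complex numbers.\<close>

definition mat_sum :: "nat \<Rightarrow> ('i \<Rightarrow> complex mat) \<Rightarrow> 'i set \<Rightarrow> complex mat" where
  "mat_sum m f S = mat m m (\<lambda>(a, b). \<Sum>r\<in>S. f r $$ (a, b))"

lemma mat_sum_carrier [simp]: "mat_sum m f S \<in> carrier_mat m m"
  by (simp add: mat_sum_def)

lemma mat_sum_index [simp]: "a < m \<Longrightarrow> b < m \<Longrightarrow> mat_sum m f S $$ (a, b) = (\<Sum>r\<in>S. f r $$ (a, b))"
  "dim_row (mat_sum m f S) = m" "dim_col (mat_sum m f S) = m"
  by (simp_all add: mat_sum_def)

lemma mat_sum_cong: "(\<And>r. r \<in> S \<Longrightarrow> f r = g r) \<Longrightarrow> mat_sum m f S = mat_sum m g S"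
  by (simp add: mat_sum_def)

lemma finsum_eq_mat_sum:
  assumes "finite S" "\<And>r. r \<in> S \<Longrightarrow> f r \<in> carrier_mat m m"
  shows "(\<Oplus>\<^bsub>module_mat TYPE(complex) m m\<^esub> r\<in>S. f r) = mat_sum m f S"
proof -
  interpret M: abelian_group "module_mat TYPE(complex) m m" by (rule abelian_group_mat)
  show ?thesis using assms
  proof (induction S rule: finite_induct)
    case empty
    then show ?case by (intro eq_matI) (simp_all add: module_mat_simps)
  next
    case (insert x S)
    then have "(\<Oplus>\<^bsub>module_mat TYPE(complex) m m\<^esub> r\<in>insert x S. f r)
        = f x + (\<Oplus>\<^bsub>module_mat TYPE(complex) m m\<^esub> r\<in>S. f r)"
      by (subst M.finsum_insert) (auto simp: module_mat_simps)
    also have "\<dots> = mat_sum m f (insert x S)"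
      using insert by (intro eq_matI) (auto simp: carrier_matD[OF insert.prems])
    finally show ?case .
  qed
qed

lemma mult_index_sum:
  assumes "A \<in> carrier_mat a m" "B \<in> carrier_mat m b" "i < a" "j < b"
  shows "(A * B) $$ (i, j) = (\<Sum>k<m. A $$ (i, k) * B $$ (k, j))"
  using assms by (simp add: scalar_prod_def lessThan_atLeast0)

lemma mult_mat_sum:
  assumes "A \<in> carrier_mat m m" "\<And>r. r \<in> S \<Longrightarrow> f r \<in> carrier_mat m m"
  shows "A * mat_sum m f S = mat_sum m (\<lambda>r. A * f r) S"
proof (rule eq_matI)
  fix i j assume "i < dim_row (mat_sum m (\<lambda>r. A * f r) S)" "j < dim_col (mat_sum m (\<lambda>r. A * f r) S)"
  then have ij: "i < m" "j < m" by simp_all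
  have "(A * mat_sum m f S) $$ (i, j) = (\<Sum>k<m. \<Sum>r\<in>S. A $$ (i, k) * f r $$ (k, j))"
    unfolding mult_index_sum[OF assms(1) mat_sum_carrier ij] using ij by (simp add: sum_distrib_left)
  also have "\<dots> = (\<Sum>r\<in>S. (A * f r) $$ (i, j))"
    by (subst sum.swap) (simp add: mult_index_sum[OF assms(1) assms(2) ij])
  finally show "(A * mat_sum m f S) $$ (i, j) = mat_sum m (\<lambda>r. A * f r) S $$ (i, j)"
    using ij by simp
qed (use assms in auto)

lemma mat_sum_mult:
  assumes "A \<in> carrier_mat m m" "\<And>r. r \<in> S \<Longrightarrow> f r \<in> carrier_mat m m"
  shows "mat_sum m f S * A = mat_sum m (\<lambda>r. f r * A) S"
proof (rule eq_matI)
  fix i j assume "i < dim_row (mat_sum m (\<lambda>r. f r * A) S)" "j < dim_col (mat_sum m (\<lambda>r. f r * A) S)"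
  then have ij: "i < m" "j < m" by simp_all
  have "(mat_sum m f S * A) $$ (i, j) = (\<Sum>k<m. \<Sum>r\<in>S. f r $$ (i, k) * A $$ (k, j))"
    unfolding mult_index_sum[OF mat_sum_carrier assms(1) ij] using ij by (simp add: sum_distrib_right)
  also have "\<dots> = (\<Sum>r\<in>S. (f r * A) $$ (i, j))"
    by (subst sum.swap) (simp add: mult_index_sum[OF assms(2) assms(1) ij])
  finally show "(mat_sum m f S * A) $$ (i, j) = mat_sum m (\<lambda>r. f r * A) S $$ (i, j)"
    using ij by simp
qed (use assms in auto)

section \<open>Adjoints, traces and positivity\<close>

abbreviation adj :: "complex mat \<Rightarrow> complex mat" where
  "adj A \<equiv> map_mat cnj (transpose_mat A)"

lemma adj_carrier: "A \<in> carrier_mat a b \<Longrightarrow> adj A \<in> carrier_mat b a"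
  by auto

lemma adj_index: "A \<in> carrier_mat a b \<Longrightarrow> i < b \<Longrightarrow> j < a \<Longrightarrow> adj A $$ (i, j) = cnj (A $$ (j, i))"
  by auto

lemma adj_adj [simp]: "adj (adj A) = A"
  by (rule eq_matI) auto

lemma map_mat_cnj_one [simp]: "map_mat cnj (1\<^sub>m a) = 1\<^sub>m a"
  by (rule eq_matI) auto

lemma adj_add: "A \<in> carrier_mat a b \<Longrightarrow> B \<in> carrier_mat a b \<Longrightarrow> adj (A + B) = adj A + adj B"
  by (rule eq_matI) auto

lemma adj_smult: "adj (c \<cdot>\<^sub>m A) = cnj c \<cdot>\<^sub>m adj A"
  by (rule eq_matI) auto

lemma adj_mult:
  assumes "A \<in> carrier_mat a m" "B \<in> carrier_mat m b"
  shows "adj (A * B) = adj B * adj A"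
proof (rule eq_matI)
  fix i j assume "i < dim_row (adj B * adj A)" "j < dim_col (adj B * adj A)"
  then have ij: "i < b" "j < a" using assms by auto
  then show "adj (A * B) $$ (i, j) = (adj B * adj A) $$ (i, j)"
    using mult_index_sum[OF assms ij(2,1)]
      mult_index_sum[OF adj_carrier[OF assms(2)] adj_carrier[OF assms(1)] ij] assms
    by (simp add: mult.commute cnj_sum)
qed (use assms in auto)

lemma adj_mat_sum:
  assumes "\<And>r. r \<in> S \<Longrightarrow> f r \<in> carrier_mat m m"
  shows "adj (mat_sum m f S) = mat_sum m (\<lambda>r. adj (f r)) S"
proof (rule eq_matI)
  fix i j assume "i < dim_row (mat_sum m (\<lambda>r. adj (f r)) S)" "j < dim_col (mat_sum m (\<lambda>r. adj (f r)) S)"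
  then have ij: "i < m" "j < m" by simp_all
  moreover have "adj (f r) $$ (i, j) = cnj (f r $$ (j, i))" if "r \<in> S" for r
    using assms[OF that] ij by auto
  ultimately show "adj (mat_sum m f S) $$ (i, j) = mat_sum m (\<lambda>r. adj (f r)) S $$ (i, j)"
    by (simp add: cnj_sum)
qed auto

lemma mat_trace_mult:
  assumes "A \<in> carrier_mat a b" "B \<in> carrier_mat b a"
  shows "mat_trace (A * B) = (\<Sum>i<a. \<Sum>k<b. A $$ (i, k) * B $$ (k, i))"
  using assms mult_index_sum[OF assms] by (auto simp: mat_trace_def intro!: sum.cong)

lemma mat_trace_comm:
  assumes "A \<in> carrier_mat a b" "B \<in> carrier_mat b a"
  shows "mat_trace (A * B) = mat_trace (B * A)"
  unfolding mat_trace_mult[OF assms] mat_trace_mult[OF assms(2,1)]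
  by (subst sum.swap) (simp add: mult.commute)

lemma mat_trace_add:
  "A \<in> carrier_mat a a \<Longrightarrow> B \<in> carrier_mat a a \<Longrightarrow> mat_trace (A + B) = mat_trace A + mat_trace B"
  by (auto simp: mat_trace_def sum.distrib)

lemma mat_trace_minus:
  "A \<in> carrier_mat a a \<Longrightarrow> B \<in> carrier_mat a a \<Longrightarrow> mat_trace (A - B) = mat_trace A - mat_trace B"
  by (auto simp: mat_trace_def sum_subtractf)

lemma mat_trace_smult: "A \<in> carrier_mat a a \<Longrightarrow> mat_trace (c \<cdot>\<^sub>m A) = c * mat_trace A"
  by (auto simp: mat_trace_def sum_distrib_left)

lemma mat_trace_adj: "A \<in> carrier_mat a a \<Longrightarrow> mat_trace (adj A) = cnj (mat_trace A)"
  by (auto simp: mat_trace_def cnj_sum)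

lemma mat_trace_mult_adj_nonneg:
  assumes "A \<in> carrier_mat a b"
  shows "mat_trace (A * adj A) \<in> \<real> \<and> 0 \<le> Re (mat_trace (A * adj A))"
proof -
  have "mat_trace (A * adj A) = (\<Sum>i<a. \<Sum>k<b. A $$ (i, k) * cnj (A $$ (i, k)))"
    unfolding mat_trace_mult[OF assms adj_carrier[OF assms]] using assms by auto
  also have "\<dots> = complex_of_real (\<Sum>i<a. \<Sum>k<b. (cmod (A $$ (i, k)))\<^sup>2)"
    by (simp only: complex_norm_square of_real_sum)
  finally show ?thesis by (simp add: sum_nonneg)
qed

text \<open>
  If \<open>D'\<close> is the adjoint of \<open>D\<close> for the inner product with Gram matrix \<open>G = F\<^sup>* F\<close>, then
  \<open>D D'\<close> has the same trace as \<open>M M\<^sup>*\<close> with \<open>M = F D G\<^sup>-\<^sup>1 F\<^sup>*\<close>.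
\<close>

lemma mat_trace_mult_adjoint_nonneg:
  assumes F: "F \<in> carrier_mat m d" and G: "G = adj F * F"
    and H: "H \<in> carrier_mat d d" "G * H = 1\<^sub>m d" "H * G = 1\<^sub>m d"
    and D: "D \<in> carrier_mat d d" and D': "D' \<in> carrier_mat d d" "G * D' = adj D * G"
  shows "mat_trace (D * D') \<in> \<real> \<and> 0 \<le> Re (mat_trace (D * D'))"
proof -
  note adjF = adj_carrier[OF F] and adjD = adj_carrier[OF D] and adjH = adj_carrier[OF H(1)]
  have Gc: "G \<in> carrier_mat d d" using F adjF unfolding G by (rule mult_carrier_mat[rotated])
  have adjG: "adj G = G" unfolding G by (simp add: adj_mult[OF adjF F])
  \<comment> \<open>\<open>adj H\<close> is a left inverse and \<open>H\<close> a right inverse of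
    the Hermitian matrix \<open>G\<close>, hence they agree.\<close>
  have "adj H * G = adj (G * H)" by (simp only: adj_mult[OF Gc H(1)] adjG)
  then have adjH_eq: "adj H = H"
    using assoc_mult_mat[OF adjH Gc H(1)] H adjH by simp
  have HaF: "H * adj F \<in> carrier_mat d m" by (rule mult_carrier_mat[OF H(1) adjF])
  have P: "D * (H * adj F) \<in> carrier_mat d m" by (rule mult_carrier_mat[OF D HaF])
  have FH: "F * H \<in> carrier_mat m d" by (rule mult_carrier_mat[OF F H(1)])
  have Q: "F * H * adj D \<in> carrier_mat m d" by (rule mult_carrier_mat[OF FH adjD])
  have QaF: "F * H * adj D * adj F \<in> carrier_mat m m" by (rule mult_carrier_mat[OF Q adjF])
  have DG: "adj D * G \<in> carrier_mat d d" by (rule mult_carrier_mat[OF adjD Gc])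
  \<comment> \<open>\<open>H * adj F\<close> is a left inverse of \<open>F\<close>, so
    \<open>M\<close> is \<open>D\<close> transported along \<open>F\<close> to the ambient space and
    extended by zero on the orthogonal complement of the image. By the adjointness relation,
    \<open>adj M\<close> is the transport of \<open>D'\<close> in the same way.\<close>
  define M where "M = F * (D * (H * adj F))"
  have "adj M = adj (D * (H * adj F)) * adj F" unfolding M_def by (rule adj_mult[OF F P])
  also have "adj (D * (H * adj F)) = adj (H * adj F) * adj D" by (rule adj_mult[OF D HaF])
  also have "adj (H * adj F) = F * H" using adj_mult[OF H(1) adjF] adjH_eq by simp
  finally have "M * adj M = F * (D * (H * adj F)) * (F * H * adj D * adj F)" by (simp only: M_def)
  also have "\<dots> = F * ((D * (H * adj F)) * (F * H * adj D * adj F))"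
    by (rule assoc_mult_mat[OF F P QaF])
  \<comment> \<open>Cyclicity of the trace moves \<open>F\<close> to the right end, where it meets
    \<open>adj F\<close> and forms \<open>G\<close>.\<close>
  finally have "mat_trace (M * adj M) = mat_trace ((D * (H * adj F)) * (F * H * adj D * adj F) * F)"
    using mat_trace_comm[OF F mult_carrier_mat[OF P QaF]] by simp
  also have "(D * (H * adj F)) * (F * H * adj D * adj F) * F = D * (H * adj F) * (F * H) * (adj D * G)"
    unfolding assoc_mult_mat[OF P QaF F] assoc_mult_mat[OF Q adjF F] G[symmetric]
      assoc_mult_mat[OF FH adjD Gc] by (rule assoc_mult_mat[OF P FH DG, symmetric])
  also have "D * (H * adj F) * (F * H) = D * H"
    unfolding assoc_mult_mat[OF D HaF FH] assoc_mult_mat[OF H(1) adjF FH]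
      assoc_mult_mat[OF adjF F H(1), symmetric] G[symmetric] H(2) right_mult_one_mat[OF H(1)] ..
  also have "D * H * (adj D * G) = D * (H * (G * D'))"
    unfolding D' by (rule assoc_mult_mat[OF D H(1) DG])
  also have "H * (G * D') = D'"
    unfolding assoc_mult_mat[OF H(1) Gc D'(1), symmetric] H(3) by (rule left_mult_one_mat[OF D'(1)])
  finally show ?thesis
    using mat_trace_mult_adj_nonneg[of M m m] mult_carrier_mat[OF F P] by (simp add: M_def)
qed

subsection \<open>Kronecker products\<close>

lemma kronecker_dims [simp]:
  "dim_row (kronecker A B) = dim_row A * dim_row B"
  "dim_col (kronecker A B) = dim_col A * dim_col B"
  by (simp_all add: kronecker_def)

lemma kronecker_carrier:
  "A \<in> carrier_mat a b \<Longrightarrow> B \<in> carrier_mat c d \<Longrightarrow> kronecker A B \<in> carrier_mat (a * c) (b * d)"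
  by auto

lemma kronecker_index:
  "i < dim_row A * dim_row B \<Longrightarrow> j < dim_col A * dim_col B \<Longrightarrow> kronecker A B $$ (i, j)
    = A $$ (i div dim_row B, j div dim_col B) * B $$ (i mod dim_row B, j mod dim_col B)"
  by (simp add: kronecker_def)

lemma div_mod_less:
  fixes i a b :: nat
  assumes "i < a * b"
  shows "i div b < a" "i mod b < b"
  using assms less_mult_imp_div_less by (auto, metis mod_less_divisor mult_0_right not_gr_zero not_less_zero)

lemma sum_lessThan_mult:
  fixes f :: "nat \<Rightarrow> 'a::comm_monoid_add"
  shows "(\<Sum>k<b * q. f k) = (\<Sum>x<b. \<Sum>y<q. f (x * q + y))"
proof -
  have "(\<Sum>k<b * q. f k) = (\<Sum>x<b. sum f {x * q..<x * q + q})"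
    by (rule sum.nat_group[symmetric])
  moreover have "sum f {x * q..<x * q + q} = (\<Sum>y<q. f (x * q + y))" for x
    using sum.shift_bounds_nat_ivl[of f 0 "x * q" q] by (simp add: add.commute lessThan_atLeast0)
  ultimately show ?thesis by simp
qed

lemma kronecker_mult:
  assumes A: "A \<in> carrier_mat a b" and C: "C \<in> carrier_mat b c"
    and B: "B \<in> carrier_mat p q" and D: "D \<in> carrier_mat q r"
  shows "kronecker A B * kronecker C D = kronecker (A * C) (B * D)"
proof (rule eq_matI)
  fix i j assume "i < dim_row (kronecker (A * C) (B * D))" "j < dim_col (kronecker (A * C) (B * D))"
  then have ij: "i < a * p" "j < c * r" using assms by auto
  note bounds = div_mod_less[OF ij(1)] div_mod_less[OF ij(2)]
  have "(kronecker A B * kronecker C D) $$ (i, j)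
      = (\<Sum>k<b * q. kronecker A B $$ (i, k) * kronecker C D $$ (k, j))"
    by (rule mult_index_sum[OF kronecker_carrier[OF A B] kronecker_carrier[OF C D] ij])
  also have "\<dots> = (\<Sum>k<b * q. (A $$ (i div p, k div q) * C $$ (k div q, j div r))
      * (B $$ (i mod p, k mod q) * D $$ (k mod q, j mod r)))"
    using assms ij by (intro sum.cong refl) (auto simp: kronecker_index)
  also have "\<dots> = (\<Sum>x<b. \<Sum>y<q. (A $$ (i div p, x) * C $$ (x, j div r))
      * (B $$ (i mod p, y) * D $$ (y, j mod r)))"
    unfolding sum_lessThan_mult by (intro sum.cong refl) auto
  also have "\<dots> = (A * C) $$ (i div p, j div r) * (B * D) $$ (i mod p, j mod r)"
    unfolding mult_index_sum[OF A C bounds(1,3)] mult_index_sum[OF B D bounds(2,4)]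
    by (simp add: sum_product)
  also have "\<dots> = kronecker (A * C) (B * D) $$ (i, j)"
    using assms ij by (subst kronecker_index) auto
  finally show "(kronecker A B * kronecker C D) $$ (i, j) = kronecker (A * C) (B * D) $$ (i, j)" .
qed (use assms in auto)

lemma kronecker_add_left:
  assumes "A \<in> carrier_mat a b" "A' \<in> carrier_mat a b"
  shows "kronecker (A + A') B = kronecker A B + kronecker A' B"
  using assms by (intro eq_matI) (auto simp: kronecker_index div_mod_less algebra_simps)

lemma kronecker_add_right:
  assumes "B \<in> carrier_mat a b" "B' \<in> carrier_mat a b"
  shows "kronecker A (B + B') = kronecker A B + kronecker A B'"
  using assms by (intro eq_matI) (auto simp: kronecker_index div_mod_less algebra_simps)

lemma kronecker_smult_left: "kronecker (c \<cdot>\<^sub>m A) B = c \<cdot>\<^sub>m kronecker A B"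
  by (intro eq_matI) (auto simp: kronecker_index div_mod_less)

lemma kronecker_smult_right: "kronecker A (c \<cdot>\<^sub>m B) = c \<cdot>\<^sub>m kronecker A B"
  by (intro eq_matI) (auto simp: kronecker_index div_mod_less)

lemma adj_kronecker: "adj (kronecker A B) = kronecker (adj A) (adj B)"
  by (intro eq_matI) (auto simp: kronecker_index div_mod_less)

lemma kronecker_one: "kronecker (1\<^sub>m a) (1\<^sub>m b) = 1\<^sub>m (a * b)"
proof (rule eq_matI)
  fix i j assume "i < dim_row (1\<^sub>m (a * b))" "j < dim_col (1\<^sub>m (a * b))"
  then have ij: "i < a * b" "j < a * b" by auto
  have "i = j \<longleftrightarrow> i div b = j div b \<and> i mod b = j mod b"
    by (metis div_mult_mod_eq)
  then show "kronecker (1\<^sub>m a) (1\<^sub>m b) $$ (i, j) = 1\<^sub>m (a * b) $$ (i, j)"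
    using ij div_mod_less[OF ij(1)] div_mod_less[OF ij(2)] by (auto simp: kronecker_index)
qed auto

lemma tensor_mats_Cons: "tensor_mats (A # As) = kronecker A (tensor_mats As)"
  by (simp add: tensor_mats_def)

text \<open>Row and column sizes are kept separate because the factors will include rectangular
  matrices that embed the strand spaces into tensor powers, not only endomorphisms.\<close>

lemma tensor_mats_carrier:
  assumes "\<And>l. l \<in> set xs \<Longrightarrow> h l \<in> carrier_mat (r l) (c l)"
  shows "tensor_mats (map h xs) \<in> carrier_mat (prod_list (map r xs)) (prod_list (map c xs))"
  using assms
proof (induction xs)
  case (Cons x xs)
  then show ?case by (auto simp only: list.map prod_list.Cons tensor_mats_Cons intro!: kronecker_carrier) auto
qed (simp add: tensor_mats_def)

lemma tensor_mats_mult: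
  assumes "\<And>l. l \<in> set xs \<Longrightarrow> h l \<in> carrier_mat (r l) (c l)"
    and "\<And>l. l \<in> set xs \<Longrightarrow> g l \<in> carrier_mat (c l) (s l)"
  shows "tensor_mats (map h xs) * tensor_mats (map g xs) = tensor_mats (map (\<lambda>l. h l * g l) xs)"
  using assms
proof (induction xs)
  case (Cons x xs)
  have "tensor_mats (map h xs) \<in> carrier_mat (prod_list (map r xs)) (prod_list (map c xs))"
    "tensor_mats (map g xs) \<in> carrier_mat (prod_list (map c xs)) (prod_list (map s xs))"
    using Cons.prems by (auto intro!: tensor_mats_carrier)
  then show ?case using Cons kronecker_mult[of "h x" "r x" "c x" "g x" "s x"]
    by (simp add: tensor_mats_Cons)
qed (simp add: tensor_mats_def)

text \<open>Distinctness of \<open>xs\<close> makes the updated factor occur exactly once, so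
  additivity of \<open>kronecker\<close> is used in one argument only: the left one at position
  \<open>i\<close>, the right one before it.\<close>

lemma tensor_mats_add:
  assumes "\<And>l. l \<in> set xs \<Longrightarrow> h l \<in> carrier_mat (r l) (c l)"
    and "A \<in> carrier_mat (r i) (c i)" "B \<in> carrier_mat (r i) (c i)" "i \<in> set xs" "distinct xs"
  shows "tensor_mats (map (h(i := A + B)) xs)
    = tensor_mats (map (h(i := A)) xs) + tensor_mats (map (h(i := B)) xs)"
  using assms
proof (induction xs)
  case (Cons x xs)
  show ?case
  proof (cases "x = i")
    case True
    then have "map (h(i := C)) xs = map h xs" for C using Cons.prems by (auto simp: map_eq_conv)
    then show ?thesis using True Cons.prems kronecker_add_left[of A "r i" "c i" B]
      by (simp only: list.map tensor_mats_Cons fun_upd_same)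
  next
    case False
    have "tensor_mats (map (h(i := C)) xs) \<in> carrier_mat (prod_list (map r xs)) (prod_list (map c xs))"
      if "C \<in> carrier_mat (r i) (c i)" for C
      using Cons.prems that by (intro tensor_mats_carrier) auto
    note carr = this[OF assms(2)] this[OF assms(3)]
    have step: "tensor_mats (map (h(i := C)) (x # xs)) = kronecker (h x) (tensor_mats (map (h(i := C)) xs))" for C
      using False by (simp add: tensor_mats_Cons)
    have IH: "tensor_mats (map (h(i := A + B)) xs)
        = tensor_mats (map (h(i := A)) xs) + tensor_mats (map (h(i := B)) xs)"
      by (rule Cons.IH) (use False Cons.prems in auto)
    show ?thesis by (simp only: step IH kronecker_add_right[OF carr])
  qed
qed simp

lemma tensor_mats_smult:
  assumes "i \<in> set xs" "distinct xs"
  shows "tensor_mats (map (h(i := a \<cdot>\<^sub>m A)) xs) = a \<cdot>\<^sub>m tensor_mats (map (h(i := A)) xs)"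
  using assms
proof (induction xs)
  case (Cons x xs)
  show ?case
  proof (cases "x = i")
    case True
    then have "map (h(i := C)) xs = map h xs" for C using Cons.prems by (auto simp: map_eq_conv)
    then show ?thesis using True
      by (simp only: list.map tensor_mats_Cons fun_upd_same kronecker_smult_left)
  next
    case False
    then show ?thesis using Cons
      by (simp add: tensor_mats_Cons kronecker_smult_right del: map_fun_upd)
  qed
qed simp

lemma adj_tensor_mats: "adj (tensor_mats (map h xs)) = tensor_mats (map (\<lambda>l. adj (h l)) xs)"
proof (induction xs)
  case (Cons x xs)
  then show ?case by (simp only: list.map tensor_mats_Cons adj_kronecker)
qed (simp add: tensor_mats_def)

lemma tensor_mats_one: "tensor_mats (map (\<lambda>l. 1\<^sub>m (r l)) xs) = 1\<^sub>m (prod_list (map r xs))"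
  by (induction xs) (simp_all add: tensor_mats_Cons kronecker_one, simp add: tensor_mats_def)

section \<open>The Casimir element of the general linear Lie algebra\<close>

text \<open>Statements about the Casimir element are tested by scalar functionals, in practice the
  entries of a matrix depending linearly on \<open>A\<close>. The laws are demanded only on
  \<open>carrier_mat n n\<close>, where the representations are linear.\<close>

definition linear_functional :: "nat \<Rightarrow> (complex mat \<Rightarrow> complex) \<Rightarrow> bool" where
  "linear_functional n \<phi> \<longleftrightarrow>
    (\<forall>A\<in>carrier_mat n n. \<forall>B\<in>carrier_mat n n. \<phi> (A + B) = \<phi> A + \<phi> B) \<and>
    (\<forall>c. \<forall>A\<in>carrier_mat n n. \<phi> (c \<cdot>\<^sub>m A) = c * \<phi> A)"

lemma linear_functional_mat_sum:
  assumes "linear_functional n \<phi>" "finite S" "\<And>r. r \<in> S \<Longrightarrow> f r \<in> carrier_mat n n"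
  shows "\<phi> (mat_sum n f S) = (\<Sum>r\<in>S. \<phi> (f r))"
  using assms(2,3)
proof (induction S rule: finite_induct)
  case empty
  have "mat_sum n f {} = 0 \<cdot>\<^sub>m 0\<^sub>m n n" by (rule eq_matI) auto
  then show ?case using assms(1) unfolding linear_functional_def by (metis mult_zero_left sum.empty zero_carrier_mat)
next
  case (insert x S)
  have fx: "f x \<in> carrier_mat n n" using insert.prems by simp
  have "mat_sum n f (insert x S) = f x + mat_sum n f S"
    using insert.hyps carrier_matD[OF fx] by (intro eq_matI) auto
  then show ?case using insert fx assms(1) unfolding linear_functional_def by simp
qed

lemma linear_functional_trace_mult:
  assumes "C \<in> carrier_mat n n"
  shows "linear_functional n (\<lambda>A. mat_trace (A * C))"
  unfolding linear_functional_def
  using assms by (auto simp: add_mult_distrib_mat[where nr = n and n = n and nc = n] mat_trace_add[where a = n]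
      mat_trace_smult[where a = n] mult_smult_assoc_mat[where nr = n and n = n and nc = n])

context
  fixes n :: nat and e :: "nat \<Rightarrow> complex mat"
  assumes onb: "gl_orthonormal_basis n e"
begin

lemma onb_carrier: "r < n\<^sup>2 \<Longrightarrow> e r \<in> carrier_mat n n"
  using onb by (simp add: gl_orthonormal_basis_def)

text \<open>Orthonormality identifies the coefficient of \<open>A\<close> at \<open>e r\<close> as
  \<open>mat_trace (A * e r)\<close>. The same expansion is evaluated at a trace functional, to find
  the coefficients, and at \<open>\<phi>\<close>, to conclude.\<close>

lemma onb_expansion:
  assumes "linear_functional n \<phi>" "A \<in> carrier_mat n n"
  shows "\<phi> A = (\<Sum>r<n\<^sup>2. mat_trace (A * e r) * \<phi> (e r))"
proof -
  obtain c where "A = (\<Oplus>\<^bsub>module_mat TYPE(complex) n n\<^esub> r\<in>{..<n\<^sup>2}. c r \<cdot>\<^sub>m e r)"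
    using onb assms(2) by (auto simp: gl_orthonormal_basis_def)
  then have A: "A = mat_sum n (\<lambda>r. c r \<cdot>\<^sub>m e r) {..<n\<^sup>2}"
    by (subst (asm) finsum_eq_mat_sum) (auto simp: onb_carrier)
  have \<psi>: "\<psi> A = (\<Sum>r<n\<^sup>2. c r * \<psi> (e r))" if "linear_functional n \<psi>" for \<psi>
    unfolding A using that
    by (subst linear_functional_mat_sum[OF that]) (auto simp: onb_carrier linear_functional_def)
  have "mat_trace (A * e s) = c s" if "s < n\<^sup>2" for s
  proof -
    have "mat_trace (A * e s) = (\<Sum>r<n\<^sup>2. c r * mat_trace (e r * e s))"
      by (rule \<psi>[OF linear_functional_trace_mult[OF onb_carrier[OF that]]])
    also have "\<dots> = (\<Sum>r<n\<^sup>2. if r = s then c s else 0)"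
      using onb that by (intro sum.cong refl) (auto simp: gl_orthonormal_basis_def)
    finally show ?thesis using that by simp
  qed
  then show ?thesis using \<psi>[OF assms(1)] by simp
qed

text \<open>The functional sending \<open>X\<close> to \<open>cnj (\<phi> (adj X))\<close> is linear
  because two conjugations cancel. Expanding \<open>adj A\<close> with it and conjugating gives the
  expansion in the matrices \<open>adj (e r)\<close>, whose orthonormality thus need not be checked
  separately.\<close>

lemma onb_expansion_adj:
  assumes "linear_functional n \<phi>" "A \<in> carrier_mat n n"
  shows "\<phi> A = (\<Sum>r<n\<^sup>2. mat_trace (A * adj (e r)) * \<phi> (adj (e r)))"
proof -
  have "linear_functional n (\<lambda>X. cnj (\<phi> (adj X)))"
    using assms(1) unfolding linear_functional_def
    by (auto simp: adj_add[where a = n and b = n] adj_smult adj_carrier)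
  from onb_expansion[OF this adj_carrier[OF assms(2)]]
  have "cnj (\<phi> A) = (\<Sum>r<n\<^sup>2. mat_trace (adj A * e r) * cnj (\<phi> (adj (e r))))" by simp
  then have "\<phi> A = cnj (\<Sum>r<n\<^sup>2. mat_trace (adj A * e r) * cnj (\<phi> (adj (e r))))"
    by (metis complex_cnj_cnj)
  also have "\<dots> = (\<Sum>r<n\<^sup>2. cnj (mat_trace (adj A * e r)) * \<phi> (adj (e r)))"
    by (simp add: cnj_sum)
  also have "cnj (mat_trace (adj A * e r)) = mat_trace (A * adj (e r))" if "r < n\<^sup>2" for r
  proof -
    note car = onb_carrier[OF that] adj_carrier[OF assms(2)] adj_carrier[OF onb_carrier[OF that]]
    have "cnj (mat_trace (adj A * e r)) = mat_trace (adj (e r) * A)"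
      using mat_trace_adj[OF mult_carrier_mat[OF car(2,1)]] adj_mult[OF car(2,1)] by simp
    then show ?thesis using mat_trace_comm[OF car(3) assms(2)] by simp
  qed
  then have "(\<Sum>r<n\<^sup>2. cnj (mat_trace (adj A * e r)) * \<phi> (adj (e r)))
      = (\<Sum>r<n\<^sup>2. mat_trace (A * adj (e r)) * \<phi> (adj (e r)))" by simp
  finally show ?thesis .
qed

context
  fixes B :: "complex mat \<Rightarrow> complex mat \<Rightarrow> complex"
  assumes lin1: "\<And>C. C \<in> carrier_mat n n \<Longrightarrow> linear_functional n (\<lambda>A. B A C)"
    and lin2: "\<And>A. A \<in> carrier_mat n n \<Longrightarrow> linear_functional n (B A)"
begin

text \<open>Expand the first \<open>adj (e r)\<close> in the basis \<open>e s\<close>; cyclicity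
  turns the coefficient into the one with which \<open>adj (e r)\<close> enters the expansion of
  \<open>e s\<close>, so the sum over \<open>r\<close> contracts in the second argument.\<close>

lemma casimir_adj: "(\<Sum>r<n\<^sup>2. B (adj (e r)) (adj (e r))) = (\<Sum>r<n\<^sup>2. B (e r) (e r))"
proof -
  note car = onb_carrier adj_carrier[OF onb_carrier]
  have "(\<Sum>r<n\<^sup>2. B (adj (e r)) (adj (e r)))
      = (\<Sum>r<n\<^sup>2. \<Sum>s<n\<^sup>2. mat_trace (adj (e r) * e s) * B (e s) (adj (e r)))"
    by (intro sum.cong refl onb_expansion[OF lin1]) (auto simp: car)
  also have "\<dots> = (\<Sum>s<n\<^sup>2. \<Sum>r<n\<^sup>2. mat_trace (e s * adj (e r)) * B (e s) (adj (e r)))"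
    by (subst sum.swap) (auto intro!: sum.cong simp: mat_trace_comm[OF car(2,1)])
  also have "\<dots> = (\<Sum>s<n\<^sup>2. B (e s) (e s))"
    by (intro sum.cong refl onb_expansion_adj[OF lin2, symmetric]) (auto simp: car)
  finally show ?thesis .
qed

text \<open>Bracketing with \<open>X\<close> is skew for the trace form. The matrix \<open>c\<close>
  of this map in the basis \<open>e\<close> is thus antisymmetric, and the two halves of the sum,
  contracted with \<open>c\<close> in opposite arguments, cancel.\<close>

lemma casimir_invariant:
  assumes X: "X \<in> carrier_mat n n"
  shows "(\<Sum>r<n\<^sup>2. B (e r * X - X * e r) (e r) + B (e r) (e r * X - X * e r)) = 0"
proof -
  define c where "c r s = mat_trace ((e r * X - X * e r) * e s)" for r s
  have car: "e r * X - X * e r \<in> carrier_mat n n" if "r < n\<^sup>2" for r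
    using onb_carrier[OF that] X by (auto intro!: minus_carrier_mat)
  have c: "c r s = - c s r" if rs: "r < n\<^sup>2" "s < n\<^sup>2" for r s
  proof -
    \<comment> \<open>After a cyclic rotation only the commutator of \<open>e s\<close> and
      \<open>e r\<close> is paired with \<open>X\<close>, so exchanging \<open>r\<close> and
      \<open>s\<close> changes the sign.\<close>
    have eq: "c r s = mat_trace (X * (e s * e r)) - mat_trace (X * (e r * e s))"
      if rs: "r < n\<^sup>2" "s < n\<^sup>2" for r s
    proof -
      note E = onb_carrier[OF rs(1)] onb_carrier[OF rs(2)]
      have "(e r * X - X * e r) * e s = e r * X * e s - X * e r * e s"
        using E X by (intro minus_mult_distrib_mat) auto
      then have "c r s = mat_trace (e r * (X * e s)) - mat_trace (X * e r * e s)"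
        unfolding c_def assoc_mult_mat[OF E(1) X E(2), symmetric]
        using E X by (simp add: mat_trace_minus[where a = n])
      also have "mat_trace (e r * (X * e s)) = mat_trace (X * e s * e r)"
        using E X by (intro mat_trace_comm) auto
      finally show ?thesis using E X by (simp add: assoc_mult_mat[where n\<^sub>1 = n and n\<^sub>2 = n and n\<^sub>3 = n and n\<^sub>4 = n])
    qed
    show ?thesis using eq[OF rs] eq[OF rs(2,1)] by simp
  qed
  have "(\<Sum>r<n\<^sup>2. B (e r * X - X * e r) (e r)) = (\<Sum>r<n\<^sup>2. \<Sum>s<n\<^sup>2. c r s * B (e s) (e r))"
    unfolding c_def by (intro sum.cong refl onb_expansion[OF lin1]) (auto simp: car onb_carrier)
  also have "\<dots> = (\<Sum>s<n\<^sup>2. \<Sum>r<n\<^sup>2. c r s * B (e s) (e r))" by (rule sum.swap)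
  also have "\<dots> = (\<Sum>s<n\<^sup>2. \<Sum>r<n\<^sup>2. - (c s r * B (e s) (e r)))"
    by (intro sum.cong refl) (subst c, auto)
  also have "\<dots> = - (\<Sum>s<n\<^sup>2. \<Sum>r<n\<^sup>2. c s r * B (e s) (e r))" by (simp add: sum_negf)
  also have "(\<Sum>s<n\<^sup>2. \<Sum>r<n\<^sup>2. c s r * B (e s) (e r)) = (\<Sum>r<n\<^sup>2. B (e r) (e r * X - X * e r))"
    unfolding c_def by (intro sum.cong refl onb_expansion[OF lin2, symmetric]) (auto simp: car onb_carrier)
  finally show ?thesis by (simp add: sum.distrib)
qed

end

end

section \<open>Weight systems and the braid relations\<close>

lemma mat_commute_mult:
  assumes "A \<in> carrier_mat m m" "B \<in> carrier_mat m m" "C \<in> carrier_mat m m"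
    and "A * B = B * A" "A * C = C * A"
  shows "A * (B * C) = (B * C) * (A :: complex mat)"
proof -
  have "A * (B * C) = B * (A * C)"
    using assms(4) assoc_mult_mat[OF assms(1,2,3)] assoc_mult_mat[OF assms(2,1,3)] by simp
  then show ?thesis using assms(5) assoc_mult_mat[OF assms(2,3,1)] by simp
qed

lemma mat_commute_mat_sum:
  assumes "A \<in> carrier_mat m m" "\<And>r. r \<in> S \<Longrightarrow> f r \<in> carrier_mat m m"
    and "\<And>r. r \<in> S \<Longrightarrow> A * f r = f r * A"
  shows "A * mat_sum m f S = mat_sum m f S * A"
  using assms by (simp add: mult_mat_sum mat_sum_mult cong: mat_sum_cong)

text \<open>Leibniz rule for the commutator with \<open>X + Y\<close>: the cross terms vanish
  because \<open>X\<close> commutes with \<open>B\<close> and \<open>Y\<close> with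
  \<open>A\<close>. It is applied to one Casimir summand and the sum of two one-strand
  actions.\<close>

lemma commutator_mult_add:
  fixes A B X Y :: "complex mat"
  assumes car: "A \<in> carrier_mat m m" "B \<in> carrier_mat m m" "X \<in> carrier_mat m m" "Y \<in> carrier_mat m m"
    and comm: "B * X = X * B" "Y * A = A * Y"
  shows "A * B * (X + Y) - (X + Y) * (A * B) = (A * X - X * A) * B + A * (B * Y - Y * B)"
proof -
  note [simp] = car
  have [simp]: "P * Q \<in> carrier_mat m m" if "P \<in> carrier_mat m m" "Q \<in> carrier_mat m m" for P Q :: "complex mat"
    using that by (rule mult_carrier_mat)
  note assoc = assoc_mult_mat[where n\<^sub>1 = m and n\<^sub>2 = m and n\<^sub>3 = m and n\<^sub>4 = m]
  have "A * B * (X + Y) - (X + Y) * (A * B) = (A * B * X + A * B * Y) - (X * (A * B) + Y * (A * B))"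
    by (simp add: mult_add_distrib_mat[where nr = m and n = m and nc = m]
        add_mult_distrib_mat[where nr = m and n = m and nc = m])
  moreover have "(A * X - X * A) * B + A * (B * Y - Y * B) = (A * X * B - X * A * B) + (A * (B * Y) - A * (Y * B))"
    by (simp add: mult_minus_distrib_mat[where nr = m and n = m and nc = m]
        minus_mult_distrib_mat[where nr = m and n = m and nc = m])
  moreover have "A * B * X = A * X * B" "X * (A * B) = X * A * B" "Y * (A * B) = A * (Y * B)"
    using comm by (simp_all add: assoc) (simp_all add: assoc[symmetric])
  moreover have "A * B * Y = A * (B * Y)" by (simp add: assoc)
  moreover have "(P + Q) - (R + T) = (P - R) + (Q - T)" if "P \<in> carrier_mat m m" "Q \<in> carrier_mat m m"
    "R \<in> carrier_mat m m" "T \<in> carrier_mat m m" for P Q R T :: "complex mat"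
    using that by (intro eq_matI) auto
  ultimately show ?thesis by simp
qed

lemma mat_eqI_carrier:
  assumes "P \<in> carrier_mat a b" "Q \<in> carrier_mat a b"
    and "\<And>i j. i < a \<Longrightarrow> j < b \<Longrightarrow> P $$ (i, j) = Q $$ (i, j)"
  shows "P = Q"
  using assms by (intro eq_matI) auto

lemma mat_diff_eq_add_index:
  fixes P Q R T :: "complex mat"
  assumes "P - Q = R + T" "P \<in> carrier_mat m m" "Q \<in> carrier_mat m m" "R \<in> carrier_mat m m"
    "T \<in> carrier_mat m m" "a < m" "b < m"
  shows "P $$ (a, b) - Q $$ (a, b) = R $$ (a, b) + T $$ (a, b)"
  using arg_cong[OF assms(1), of "\<lambda>M. M $$ (a, b)"] assms(2-) by simp

section \<open>Operators on single strands, and the braid relations for Casimir operators\<close>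

locale gl_strands =
  fixes n N :: nat and e :: "nat \<Rightarrow> complex mat" and d :: "nat \<Rightarrow> nat"
    and \<rho> :: "nat \<Rightarrow> complex mat \<Rightarrow> complex mat"
  assumes onb: "gl_orthonormal_basis n e"
    and rep: "\<And>i. i \<in> {1..N} \<Longrightarrow> gl_rep n (d i) (\<rho> i)"
begin

abbreviation "D \<equiv> tensor_dim N d"

abbreviation "tensor h \<equiv> tensor_mats (map h [1..<N + 1])"

lemma D_eq: "D = prod_list (map d [1..<N + 1])"
  unfolding tensor_dim_def
  using prod.distinct_set_conv_list[of "[1..<N + 1]" d, OF distinct_upt]
  by (simp add: atLeastLessThanSuc_atLeastAtMost del: upt_Suc)

lemma rep_carrier: "l \<in> {1..N} \<Longrightarrow> A \<in> carrier_mat n n \<Longrightarrow> \<rho> l A \<in> carrier_mat (d l) (d l)"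
  using rep[of l] by (simp add: gl_rep_def)

lemma tensor_carrier:
  assumes "\<And>l. l \<in> {1..N} \<Longrightarrow> h l \<in> carrier_mat (d l) (d l)"
  shows "tensor h \<in> carrier_mat D D"
  unfolding D_eq using assms by (intro tensor_mats_carrier) auto

lemma tensor_mult:
  assumes "\<And>l. l \<in> {1..N} \<Longrightarrow> h l \<in> carrier_mat (d l) (d l)"
    and "\<And>l. l \<in> {1..N} \<Longrightarrow> g l \<in> carrier_mat (d l) (d l)"
  shows "tensor h * tensor g = tensor (\<lambda>l. h l * g l)"
  using assms by (intro tensor_mats_mult[where r = d and c = d and s = d]) auto

definition slot :: "nat \<Rightarrow> complex mat \<Rightarrow> complex mat" where
  "slot i A = tensor ((\<lambda>l. 1\<^sub>m (d l))(i := A))"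

definition emb :: "nat \<Rightarrow> complex mat \<Rightarrow> complex mat" where
  "emb i A = slot i (\<rho> i A)"

lemma slot_carrier: "i \<in> {1..N} \<Longrightarrow> A \<in> carrier_mat (d i) (d i) \<Longrightarrow> slot i A \<in> carrier_mat D D"
  unfolding slot_def by (intro tensor_carrier) auto

lemma slot_add:
  assumes "i \<in> {1..N}" "A \<in> carrier_mat (d i) (d i)" "B \<in> carrier_mat (d i) (d i)"
  shows "slot i (A + B) = slot i A + slot i B"
  unfolding slot_def using assms by (intro tensor_mats_add[where r = d and c = d]) auto

lemma slot_smult: "i \<in> {1..N} \<Longrightarrow> slot i (c \<cdot>\<^sub>m A) = c \<cdot>\<^sub>m slot i A"
  unfolding slot_def by (intro tensor_mats_smult) auto

lemma slot_mult:
  assumes "i \<in> {1..N}" "A \<in> carrier_mat (d i) (d i)" "B \<in> carrier_mat (d i) (d i)"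
  shows "slot i A * slot i B = slot i (A * B)"
  unfolding slot_def using assms
  by (subst tensor_mult) (auto intro!: arg_cong[of _ _ tensor_mats])

lemma minus_eq_add_smult: "A \<in> carrier_mat a b \<Longrightarrow> B \<in> carrier_mat a b \<Longrightarrow> A - B = A + (- 1 :: complex) \<cdot>\<^sub>m B"
  by (intro eq_matI) auto

lemma slot_minus:
  assumes "i \<in> {1..N}" "A \<in> carrier_mat (d i) (d i)" "B \<in> carrier_mat (d i) (d i)"
  shows "slot i (A - B) = slot i A - slot i B"
  using assms slot_carrier[OF assms(1)]
  by (simp add: minus_eq_add_smult[where a = "d i" and b = "d i"] minus_eq_add_smult[where a = D and b = D]
      slot_add slot_smult)

lemma slot_commute:
  assumes "i \<in> {1..N}" "j \<in> {1..N}" "i \<noteq> j"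
    and "A \<in> carrier_mat (d i) (d i)" "B \<in> carrier_mat (d j) (d j)"
  shows "slot i A * slot j B = slot j B * slot i A"
  unfolding slot_def using assms
  by (subst (1 2) tensor_mult) (auto intro!: arg_cong[of _ _ tensor_mats])

lemma emb_carrier [simp]: "i \<in> {1..N} \<Longrightarrow> A \<in> carrier_mat n n \<Longrightarrow> emb i A \<in> carrier_mat D D"
  unfolding emb_def by (intro slot_carrier rep_carrier)

lemma emb_add:
  "i \<in> {1..N} \<Longrightarrow> A \<in> carrier_mat n n \<Longrightarrow> B \<in> carrier_mat n n \<Longrightarrow> emb i (A + B) = emb i A + emb i B"
  using rep[of i] by (simp add: emb_def gl_rep_def slot_add)

lemma emb_smult: "i \<in> {1..N} \<Longrightarrow> A \<in> carrier_mat n n \<Longrightarrow> emb i (c \<cdot>\<^sub>m A) = c \<cdot>\<^sub>m emb i A"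
  using rep[of i] by (simp add: emb_def gl_rep_def slot_smult)

lemma emb_bracket:
  assumes "i \<in> {1..N}" "A \<in> carrier_mat n n" "B \<in> carrier_mat n n"
  shows "emb i (A * B - B * A) = emb i A * emb i B - emb i B * emb i A"
proof -
  note car = rep_carrier[OF assms(1,2)] rep_carrier[OF assms(1,3)]
  have "\<rho> i (A * B - B * A) = \<rho> i A * \<rho> i B - \<rho> i B * \<rho> i A"
    using rep[OF assms(1)] assms by (simp add: gl_rep_def)
  then show ?thesis using car assms(1) by (simp add: emb_def slot_mult slot_minus)
qed

lemma emb_commute:
  "i \<in> {1..N} \<Longrightarrow> j \<in> {1..N} \<Longrightarrow> i \<noteq> j \<Longrightarrow> A \<in> carrier_mat n n \<Longrightarrow> B \<in> carrier_mat n n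
    \<Longrightarrow> emb i A * emb j B = emb j B * emb i A"
  unfolding emb_def by (intro slot_commute rep_carrier)

text \<open>The chord operator in factored form: each summand is a product of two one-strand
  operators, which can be moved past operators on other strands and past a Gram matrix one factor at
  a time.\<close>

definition casimir :: "nat \<Rightarrow> nat \<Rightarrow> complex mat" where
  "casimir i j = mat_sum D (\<lambda>r. emb i (e r) * emb j (e r)) {..<n\<^sup>2}"

lemma casimir_carrier [simp]: "casimir i j \<in> carrier_mat D D"
  by (simp add: casimir_def)

lemma e_carrier [simp]: "r < n\<^sup>2 \<Longrightarrow> e r \<in> carrier_mat n n"
  by (rule onb_carrier[OF onb])

lemma emb_mult_carrier [simp]:
  "i \<in> {1..N} \<Longrightarrow> j \<in> {1..N} \<Longrightarrow> A \<in> carrier_mat n n \<Longrightarrow> B \<in> carrier_mat n n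
    \<Longrightarrow> emb i A * emb j B \<in> carrier_mat D D"
  by (rule mult_carrier_mat[of _ D D]) simp_all

lemma casimir_sym:
  "i \<in> {1..N} \<Longrightarrow> j \<in> {1..N} \<Longrightarrow> i \<noteq> j \<Longrightarrow> casimir i j = casimir j i"
  unfolding casimir_def by (intro mat_sum_cong emb_commute) auto

text \<open>Fixing an entry \<open>(a, b)\<close> makes the matrix-valued bilinear map scalar, as
  the lemmas on the Casimir element require.\<close>

lemma linear_functional_emb:
  assumes "i \<in> {1..N}" "j \<in> {1..N}" "C \<in> carrier_mat n n" "a < D" "b < D"
  shows "linear_functional n (\<lambda>A. (emb i A * emb j C) $$ (a, b))"
    and "linear_functional n (\<lambda>A. (emb i C * emb j A) $$ (a, b))"
  using assms unfolding linear_functional_def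
  by (auto simp: emb_add emb_smult add_mult_distrib_mat[where nr = D and n = D and nc = D]
      mult_add_distrib_mat[where nr = D and n = D and nc = D]
      mult_smult_assoc_mat[where nr = D and n = D and nc = D]
      mult_smult_distrib[where nr = D and n = D and nc = D] carrier_matD[OF emb_carrier]
      simp del: index_mult_mat(1))

text \<open>By the Leibniz rule each entry of the commutator is a sum of the form that
  \<open>casimir_invariant\<close> shows to vanish. This is the infinitesimal invariance behind the
  4T relation.\<close>

lemma casimir_commute_emb:
  assumes ij: "i \<in> {1..N}" "j \<in> {1..N}" "i \<noteq> j" and X: "X \<in> carrier_mat n n"
  shows "casimir i j * (emb i X + emb j X) = (emb i X + emb j X) * casimir i j"
proof -
  let ?Y = "emb i X + emb j X"
  have Y: "?Y \<in> carrier_mat D D" using ij X by simp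
  have Ec: "emb i (e r) * emb j (e r) \<in> carrier_mat D D" if "r \<in> {..<n\<^sup>2}" for r
    using that ij by simp
  have left: "casimir i j * ?Y = mat_sum D (\<lambda>r. emb i (e r) * emb j (e r) * ?Y) {..<n\<^sup>2}"
    unfolding casimir_def by (rule mat_sum_mult[OF Y]) (rule Ec)
  have right: "?Y * casimir i j = mat_sum D (\<lambda>r. ?Y * (emb i (e r) * emb j (e r))) {..<n\<^sup>2}"
    unfolding casimir_def by (rule mult_mat_sum[OF Y]) (rule Ec)
  have summand: "emb i (e r) * emb j (e r) * ?Y - ?Y * (emb i (e r) * emb j (e r))
      = emb i (e r * X - X * e r) * emb j (e r) + emb i (e r) * emb j (e r * X - X * e r)"
    if "r < n\<^sup>2" for r
    using that ij X by (simp add: emb_bracket commutator_mult_add[where m = D] emb_commute)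
  have "(casimir i j * ?Y) $$ (a, b) - (?Y * casimir i j) $$ (a, b) = 0" if ab: "a < D" "b < D" for a b
  proof -
    let ?B = "\<lambda>A C. (emb i A * emb j C) $$ (a, b)"
    have entry: "(emb i (e r) * emb j (e r) * ?Y) $$ (a, b) - (?Y * (emb i (e r) * emb j (e r))) $$ (a, b)
        = ?B (e r * X - X * e r) (e r) + ?B (e r) (e r * X - X * e r)" if r: "r < n\<^sup>2" for r
    proof -
      have E: "emb i (e r) * emb j (e r) \<in> carrier_mat D D" using ij r by simp
      have car: "e r * X - X * e r \<in> carrier_mat n n" using r X by (auto intro!: minus_carrier_mat)
      show ?thesis
        by (rule mat_diff_eq_add_index[OF summand[OF r] mult_carrier_mat[OF E Y] mult_carrier_mat[OF Y E]
            emb_mult_carrier[OF ij(1,2) car e_carrier[OF r]] emb_mult_carrier[OF ij(1,2) e_carrier[OF r] car] ab])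
    qed
    have "(casimir i j * ?Y) $$ (a, b) - (?Y * casimir i j) $$ (a, b)
        = (\<Sum>r<n\<^sup>2. (emb i (e r) * emb j (e r) * ?Y) $$ (a, b) - (?Y * (emb i (e r) * emb j (e r))) $$ (a, b))"
      unfolding left right using ab
      by (simp add: sum_subtractf del: index_mult_mat(1))
    also have "\<dots> = (\<Sum>r<n\<^sup>2. ?B (e r * X - X * e r) (e r) + ?B (e r) (e r * X - X * e r))"
      using entry by (intro sum.cong refl) auto
    also have "\<dots> = 0"
      using ij ab X by (intro casimir_invariant[OF onb]) (auto intro!: linear_functional_emb simp del: index_mult_mat(1))
    finally show ?thesis .
  qed
  then show ?thesis
    by (intro mat_eqI_carrier[OF mult_carrier_mat[OF casimir_carrier Y] mult_carrier_mat[OF Y casimir_carrier]])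
      simp
qed

lemma casimir_2T:
  assumes "{i, j, k, l} \<subseteq> {1..N}" "distinct [i, j, k, l]"
  shows "casimir i j * casimir k l = casimir k l * casimir i j"
proof -
  have comm: "casimir i j * emb m A = emb m A * casimir i j"
    if "m \<in> {k, l}" "A \<in> carrier_mat n n" for m A
    unfolding casimir_def using assms that
    by (intro mat_commute_mat_sum[symmetric] mat_commute_mult[where m = D]) (auto intro!: emb_commute)
  show ?thesis unfolding casimir_def[of k l] using assms
    by (intro mat_commute_mat_sum mat_commute_mult[where m = D] comm) auto
qed

text \<open>The two chords ending at \<open>k\<close> add up to a sum of products of a diagonal
  action on \<open>i\<close> and \<open>j\<close> with an operator on \<open>k\<close>. Each factor
  commutes with \<open>casimir i j\<close>: the first by invariance, the second because
  \<open>k\<close> is another strand.\<close>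

lemma casimir_4T:
  assumes ijk: "{i, j, k} \<subseteq> {1..N}" "distinct [i, j, k]"
  shows "casimir i j * casimir i k + casimir i j * casimir j k
    = casimir i k * casimir i j + casimir j k * casimir i j"
proof -
  have "casimir i k + casimir j k = mat_sum D (\<lambda>r. (emb i (e r) + emb j (e r)) * emb k (e r)) {..<n\<^sup>2}"
    (is "_ = ?S")
    unfolding casimir_def using ijk
    by (intro eq_matI) (auto simp: sum.distrib add_mult_distrib_mat[where nr = D and n = D and nc = D]
        carrier_matD[OF emb_carrier] simp del: index_mult_mat(1))
  moreover have "casimir i j * ?S = ?S * casimir i j"
  proof (intro mat_commute_mat_sum mat_commute_mult[where m = D])
    fix r assume r: "r \<in> {..<n\<^sup>2}"
    show "casimir i j * (emb i (e r) + emb j (e r)) = (emb i (e r) + emb j (e r)) * casimir i j"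
      using ijk r by (intro casimir_commute_emb) auto
    have "emb k (e r) * casimir i j = casimir i j * emb k (e r)"
      unfolding casimir_def using ijk r
      by (intro mat_commute_mat_sum mat_commute_mult[where m = D]) (auto intro!: emb_commute)
    then show "casimir i j * emb k (e r) = emb k (e r) * casimir i j" by simp
    show "(emb i (e r) + emb j (e r)) * emb k (e r) \<in> carrier_mat D D"
      using ijk r by (intro mult_carrier_mat[of _ D D]) auto
  qed (use ijk in auto)
  ultimately show ?thesis
    using mult_add_distrib_mat[OF casimir_carrier casimir_carrier casimir_carrier, of i j i k j k]
      add_mult_distrib_mat[OF casimir_carrier casimir_carrier casimir_carrier, of i k j k i j]
    by simp
qed

end

section \<open>Operators of words and combinations, and their descent to the quotient\<close>

lemma sum_keys_superset:
  fixes g :: "'a \<Rightarrow> complex"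
  assumes "finite S" "Poly_Mapping.keys p \<subseteq> S"
  shows "(\<Sum>w\<in>Poly_Mapping.keys p. Poly_Mapping.lookup p w * g w) = (\<Sum>w\<in>S. Poly_Mapping.lookup p w * g w)"
  using assms by (intro sum.mono_neutral_left) (auto simp: in_keys_iff)

text \<open>Cancellation can shrink the support of \<open>p + q\<close>, so all three sums are taken
  over the union of the supports of \<open>p\<close> and \<open>q\<close>.\<close>

lemma sum_keys_add:
  fixes g :: "'a \<Rightarrow> complex"
  shows "(\<Sum>w\<in>Poly_Mapping.keys (p + q). Poly_Mapping.lookup (p + q) w * g w)
    = (\<Sum>w\<in>Poly_Mapping.keys p. Poly_Mapping.lookup p w * g w)
      + (\<Sum>w\<in>Poly_Mapping.keys q. Poly_Mapping.lookup q w * g w)"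
proof -
  let ?S = "Poly_Mapping.keys p \<union> Poly_Mapping.keys q"
  have "Poly_Mapping.keys (p + q) \<subseteq> ?S" by (rule keys_add)
  then show ?thesis
    using sum_keys_superset[of ?S "p + q" g] sum_keys_superset[of ?S p g] sum_keys_superset[of ?S q g]
    by (simp add: lookup_add distrib_right sum.distrib)
qed

lemma smult_smult_mat: "a \<cdot>\<^sub>m (b \<cdot>\<^sub>m A) = (a * b) \<cdot>\<^sub>m (A :: complex mat)"
  by (intro eq_matI) auto

lemma one_smult_mat: "1 \<cdot>\<^sub>m A = (A :: complex mat)"
  by (intro eq_matI) auto

context gl_strands
begin

abbreviation "chord_op \<equiv> chord_operator n N e d \<rho>"
abbreviation "word_op \<equiv> diagram_operator n N e d \<rho>"
abbreviation "comb_op \<equiv> combination_operator n N e d \<rho>"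

lemma chord_operator_eq:
  "chord_op (i, j) = mat_sum D (\<lambda>r. tensor (\<lambda>l. if l = i \<or> l = j then \<rho> l (e r) else 1\<^sub>m (d l))) {..<n\<^sup>2}"
  unfolding chord_operator_def prod.case
  by (intro finsum_eq_mat_sum tensor_carrier) (auto intro: rep_carrier)

lemma chord_operator_carrier: "chord_op c \<in> carrier_mat D D"
  by (cases c) (simp add: chord_operator_eq)

lemma emb_mult_emb:
  assumes "i \<in> {1..N}" "j \<in> {1..N}" "i \<noteq> j" "A \<in> carrier_mat n n" "B \<in> carrier_mat n n"
  shows "emb i A * emb j B
    = tensor (\<lambda>l. if l = i then \<rho> l A else if l = j then \<rho> l B else 1\<^sub>m (d l))"
  unfolding emb_def slot_def
  using assms
  by (subst tensor_mult) (auto intro!: arg_cong[of _ _ tensor_mats] rep_carrier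
      simp: right_mult_one_mat[OF rep_carrier] left_mult_one_mat[OF rep_carrier])

lemma chord_operator_casimir:
  assumes "i \<in> {1..N}" "j \<in> {1..N}" "i \<noteq> j"
  shows "chord_op (i, j) = casimir i j"
  unfolding chord_operator_eq casimir_def
  using assms by (intro mat_sum_cong) (auto simp: emb_mult_emb intro!: arg_cong[of _ _ tensor_mats])

lemma diagram_operator_carrier: "word_op w \<in> carrier_mat D D"
proof -
  have "foldr (\<lambda>c M. chord_op c * M) cs (1\<^sub>m D) \<in> carrier_mat D D" for cs
    by (induction cs) (auto intro: mult_carrier_mat[OF chord_operator_carrier])
  then show ?thesis unfolding diagram_operator_def .
qed

lemma diagram_operator_add: "word_op (v + w) = word_op v * word_op w"
proof -
  have "word_op (Word (cs @ letters w)) = word_op (Word cs) * word_op w" for cs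
  proof (induction cs)
    case Nil
    then show ?case using left_mult_one_mat[OF diagram_operator_carrier[of w]]
      by (simp add: diagram_operator_def)
  next
    case (Cons c cs)
    have "word_op (Word (c # bs)) = chord_op c * word_op (Word bs)" for bs
      by (simp add: diagram_operator_def)
    then show ?case using Cons
      by (simp add: assoc_mult_mat[OF chord_operator_carrier diagram_operator_carrier diagram_operator_carrier])
  qed
  from this[of "letters v"] show ?thesis by (simp add: plus_free_word_def)
qed

lemma diagram_operator_zero: "word_op 0 = 1\<^sub>m D"
  by (simp add: diagram_operator_def zero_free_word_def)

lemma combination_operator_eq:
  "comb_op p = mat_sum D (\<lambda>w. Poly_Mapping.lookup p w \<cdot>\<^sub>m word_op w) (Poly_Mapping.keys p)"
  unfolding combination_operator_def
  by (intro finsum_eq_mat_sum) (simp_all add: smult_carrier_mat diagram_operator_carrier)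

lemma combination_operator_carrier: "comb_op p \<in> carrier_mat D D"
  by (simp add: combination_operator_eq)

lemma combination_operator_index:
  assumes "a < D" "b < D"
  shows "comb_op p $$ (a, b)
    = (\<Sum>w\<in>Poly_Mapping.keys p. Poly_Mapping.lookup p w * word_op w $$ (a, b))"
  using assms carrier_matD[OF diagram_operator_carrier] by (simp add: combination_operator_eq)

lemma combination_operator_zero: "comb_op 0 = 0\<^sub>m D D"
  by (rule mat_eqI_carrier[OF combination_operator_carrier zero_carrier_mat])
    (simp add: combination_operator_index)

lemma combination_operator_add: "comb_op (p + q) = comb_op p + comb_op q"
  using combination_operator_carrier[of p] combination_operator_carrier[of q]
  by (intro mat_eqI_carrier[OF combination_operator_carrier])
    (auto simp: combination_operator_index sum_keys_add)

lemma combination_operator_single: "comb_op (Poly_Mapping.single w c) = c \<cdot>\<^sub>m word_op w"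
  using diagram_operator_carrier[of w]
  by (intro mat_eqI_carrier[OF combination_operator_carrier]) (auto simp: combination_operator_index)

lemma combination_operator_one: "comb_op 1 = 1\<^sub>m D"
  unfolding single_one[symmetric] combination_operator_single diagram_operator_zero
  by (intro eq_matI) auto

lemma combination_operator_mult: "comb_op (p * q) = comb_op p * comb_op q"
proof (induction p rule: poly_mapping_single_induct)
  case zero
  then show ?case using left_mult_zero_mat[OF combination_operator_carrier] by (simp add: combination_operator_zero)
next
  case (add_single p v c)
  note car = combination_operator_carrier diagram_operator_carrier
  have "comb_op (Poly_Mapping.single v c * q) = comb_op (Poly_Mapping.single v c) * comb_op q"
  proof (induction q rule: poly_mapping_single_induct)
    case zero
    then show ?case using right_mult_zero_mat[OF combination_operator_carrier] by (simp add: combination_operator_zero)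
  next
    case (add_single q w c')
    have "comb_op (Poly_Mapping.single v c * Poly_Mapping.single w c')
        = comb_op (Poly_Mapping.single v c) * comb_op (Poly_Mapping.single w c')"
      using car by (simp add: mult_single combination_operator_single diagram_operator_add
          mult_smult_assoc_mat[OF diagram_operator_carrier, of _ D]
          mult_smult_distrib[OF diagram_operator_carrier diagram_operator_carrier] smult_smult_mat)
    then show ?case using add_single
      by (simp add: distrib_left combination_operator_add mult_add_distrib_mat[OF car(1) car(1) car(1)])
  qed
  then show ?case using add_single
    by (simp add: distrib_right combination_operator_add add_mult_distrib_mat[OF car(1) car(1) car(1)])
qed

lemma combination_operator_scale: "comb_op (scale c p) = c \<cdot>\<^sub>m comb_op p"
  unfolding scale_eq_mult combination_operator_mult combination_operator_single diagram_operator_zero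
  using combination_operator_carrier[of p]
  by (simp add: mult_smult_assoc_mat[OF one_carrier_mat combination_operator_carrier])

lemma combination_operator_diff: "comb_op (p - q) = comb_op p - comb_op q"
proof -
  have "p = (p - q) + q" by simp
  then have "comb_op p = comb_op (p - q) + comb_op q" by (metis combination_operator_add)
  then show ?thesis
    using combination_operator_carrier[of "p - q"] combination_operator_carrier[of q]
    by (intro eq_matI) auto
qed

text \<open>\<open>chord\<close> stores its endpoints in increasing order; \<open>casimir\<close> is
  symmetric because operators on distinct strands commute, so the order does not matter.\<close>

lemma combination_operator_chord:
  assumes "i \<in> {1..N}" "j \<in> {1..N}" "i \<noteq> j"
  shows "comb_op (chord i j) = casimir i j"
proof -
  have "comb_op (chord i j) = chord_op (min i j, max i j)"
    using right_mult_one_mat[OF chord_operator_carrier[of "(min i j, max i j)"]]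
    by (simp add: one_smult_mat chord_def combination_operator_single diagram_operator_def)
  also have "\<dots> = casimir i j"
    using assms chord_operator_casimir[of "min i j" "max i j"] casimir_sym[of i j]
    by (auto simp: min_def max_def split: if_splits)
  finally show ?thesis .
qed

text \<open>The combinations with zero operator form an ideal because \<open>comb_op\<close> is
  additive and multiplicative, so only the relations matter, and these are \<open>casimir_2T\<close>
  and \<open>casimir_4T\<close>.\<close>

lemma combination_operator_braid_ideal:
  assumes "p \<in> braid_ideal N"
  shows "comb_op p = 0\<^sub>m D D"
proof -
  let ?J = "{p \<in> carrier (diagram_ring N). comb_op p = 0\<^sub>m D D}"
  interpret R: ring "diagram_ring N" by (rule ring_diagram_ring)
  have "ideal ?J (diagram_ring N)"
  proof (rule ideal_diagram_ringI)
    fix p q assume "p \<in> ?J" "q \<in> ?J"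
    then show "p + q \<in> ?J" using R.a_closed[of p q] by (simp add: combination_operator_add)
  next
    fix p assume "p \<in> ?J"
    then show "- p \<in> ?J" using combination_operator_diff[of 0 p]
      by (simp add: keys_uminus combination_operator_zero)
  next
    fix p x assume "p \<in> ?J" "x \<in> carrier (diagram_ring N)"
    then show "x * p \<in> ?J" "p * x \<in> ?J"
      using R.m_closed[of x p] R.m_closed[of p x]
      by (simp_all add: combination_operator_mult left_mult_zero_mat[OF combination_operator_carrier]
          right_mult_zero_mat[OF combination_operator_carrier])
  qed (auto simp: combination_operator_zero)
  moreover have "relations_2T N \<subseteq> ?J"
  proof
    fix p assume p: "p \<in> relations_2T N"
    then obtain i j k l where "p = chord i j * chord k l - chord k l * chord i j"
      "{i, j, k, l} \<subseteq> {1..N}" "distinct [i, j, k, l]"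
      by (auto simp: relations_2T_def)
    then have "comb_op p = 0\<^sub>m D D"
      using casimir_2T[of i j k l] minus_r_inv_mat[OF mult_carrier_mat[OF casimir_carrier casimir_carrier], of k l i j]
      by (simp add: combination_operator_diff combination_operator_mult combination_operator_chord)
    then show "p \<in> ?J" using p relations_subset_carrier[of N] by blast
  qed
  moreover have "relations_4T N \<subseteq> ?J"
  proof
    fix p assume p: "p \<in> relations_4T N"
    then obtain i j k where ijk: "{i, j, k} \<subseteq> {1..N}" "distinct [i, j, k]"
      "p = chord i j * chord i k + chord i j * chord j k - chord i k * chord i j - chord j k * chord i j"
      by (auto simp: relations_4T_def)
    then have "p = (chord i j * chord i k + chord i j * chord j k) - (chord i k * chord i j + chord j k * chord i j)"
      by simp
    moreover have "casimir i k * casimir i j + casimir j k * casimir i j \<in> carrier_mat D D"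
      by (intro add_carrier_mat mult_carrier_mat[OF casimir_carrier casimir_carrier])
    ultimately have "comb_op p = 0\<^sub>m D D"
      using casimir_4T[OF ijk(1,2)] ijk(1,2) minus_r_inv_mat
      by (simp add: combination_operator_diff combination_operator_add combination_operator_mult combination_operator_chord)
    then show "p \<in> ?J" using p relations_subset_carrier[of N] by blast
  qed
  ultimately show ?thesis using braid_ideal_least[of ?J N] assms by blast
qed

text \<open>Representatives differ by an element of the ideal and so have equal operators; the image
  of the coset is a singleton, on which \<open>the_elem\<close> has its intended value.\<close>

lemma operator_weight_system_coset: "operator_weight_system n N e d \<rho> (braid_coset N p) = comb_op p"
proof -
  have "comb_op q = comb_op p" if "q \<in> braid_coset N p" for q
  proof -
    have "comb_op (q - p) = 0\<^sub>m D D"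
      using that by (intro combination_operator_braid_ideal) (simp add: mem_braid_coset)
    then show ?thesis
      using combination_operator_add[of "q - p" p] left_add_zero_mat[OF combination_operator_carrier[of p]] by simp
  qed
  moreover have "p \<in> braid_coset N p" by (simp add: mem_braid_coset braid_ideal_closed(2))
  ultimately have "comb_op ` braid_coset N p = {comb_op p}" by blast
  then show ?thesis by (simp add: operator_weight_system_def)
qed

text \<open>
  The hypothesis on \<open>G\<close> says that, for the Hermitian form with Gram matrix \<open>G l\<close> on the \<open>l\<close>-th
  strand, the adjoint of \<open>\<rho> l A\<close> is \<open>\<rho> l\<close> of the conjugate transpose of \<open>A\<close>.
\<close>

context
  fixes G :: "nat \<Rightarrow> complex mat"
  assumes G_carrier: "\<And>l. l \<in> {1..N} \<Longrightarrow> G l \<in> carrier_mat (d l) (d l)"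
    and G_adj: "\<And>l A. l \<in> {1..N} \<Longrightarrow> A \<in> carrier_mat n n \<Longrightarrow> G l * \<rho> l A = adj (\<rho> l (adj A)) * G l"
begin

lemma tensor_G_carrier: "tensor G \<in> carrier_mat D D"
  by (rule tensor_carrier[OF G_carrier])

text \<open>Slot \<open>i\<close> uses the hypothesis on \<open>G\<close>; in every other slot
  \<open>G l\<close> only meets an identity matrix.\<close>

lemma tensor_G_emb:
  assumes "i \<in> {1..N}" "A \<in> carrier_mat n n"
  shows "tensor G * emb i A = adj (emb i (adj A)) * tensor G"
proof -
  note car = rep_carrier[OF assms] rep_carrier[OF assms(1) adj_carrier[OF assms(2)]]
  let ?h = "(\<lambda>l. 1\<^sub>m (d l))(i := \<rho> i A)" and ?h' = "(\<lambda>l. 1\<^sub>m (d l))(i := \<rho> i (adj A))"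
  have "tensor G * tensor ?h = tensor (\<lambda>l. G l * ?h l)"
    using assms car G_carrier by (intro tensor_mult) auto
  also have "\<dots> = tensor (\<lambda>l. adj (?h' l) * G l)"
  proof (intro arg_cong[of _ _ tensor_mats] map_cong refl)
    fix l assume "l \<in> set [1..<N + 1]"
    then have "l \<in> {1..N}" by auto
    then show "G l * ?h l = adj (?h' l) * G l" using G_carrier[of l] G_adj[of l A] assms by (cases "l = i") simp_all
  qed
  also have "\<dots> = tensor (\<lambda>l. adj (?h' l)) * tensor G"
    using assms car G_carrier by (intro tensor_mult[symmetric]) (auto intro!: adj_carrier)
  also have "tensor (\<lambda>l. adj (?h' l)) = adj (tensor ?h')" by (rule adj_tensor_mats[symmetric])
  finally show ?thesis by (simp only: emb_def slot_def)
qed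

text \<open>Moving the Gram matrix through a summand replaces both copies of \<open>e r\<close> by
  \<open>adj (e r)\<close>; only the sum over \<open>r\<close> returns to the original basis, by
  \<open>casimir_adj\<close>.\<close>

lemma tensor_G_casimir:
  assumes ij: "i \<in> {1..N}" "j \<in> {1..N}" "i \<noteq> j"
  shows "tensor G * casimir i j = adj (casimir i j) * tensor G"
proof -
  note G = tensor_G_carrier
  have ec: "e r \<in> carrier_mat n n" "adj (e r) \<in> carrier_mat n n" if "r \<in> {..<n\<^sup>2}" for r
    using that by (auto intro: adj_carrier)
  have "tensor G * casimir i j = mat_sum D (\<lambda>r. tensor G * (emb i (e r) * emb j (e r))) {..<n\<^sup>2}"
    unfolding casimir_def by (rule mult_mat_sum[OF G]) (use ij in simp)
  also have "\<dots> = mat_sum D (\<lambda>r. adj (emb i (adj (e r)) * emb j (adj (e r))) * tensor G) {..<n\<^sup>2}"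
  proof (rule mat_sum_cong)
    fix r assume r: "r \<in> {..<n\<^sup>2}"
    note c = emb_carrier[OF ij(1) ec(1)[OF r]] emb_carrier[OF ij(2) ec(1)[OF r]]
      emb_carrier[OF ij(1) ec(2)[OF r]] emb_carrier[OF ij(2) ec(2)[OF r]]
    have "tensor G * (emb i (e r) * emb j (e r)) = adj (emb i (adj (e r))) * (tensor G * emb j (e r))"
      unfolding assoc_mult_mat[OF G c(1,2), symmetric] tensor_G_emb[OF ij(1) ec(1)[OF r]]
      by (rule assoc_mult_mat[OF adj_carrier[OF c(3)] G c(2)])
    also have "\<dots> = adj (emb i (adj (e r))) * adj (emb j (adj (e r))) * tensor G"
      unfolding tensor_G_emb[OF ij(2) ec(1)[OF r]]
      by (rule assoc_mult_mat[OF adj_carrier[OF c(3)] adj_carrier[OF c(4)] G, symmetric])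
    \<comment> \<open>Collecting two adjoints into one reverses the factors; the two strands
      commute, so the order is restored.\<close>
    also have "\<dots> = adj (emb i (adj (e r)) * emb j (adj (e r))) * tensor G"
      unfolding emb_commute[OF ij ec(2)[OF r] ec(2)[OF r]] adj_mult[OF c(4,3)] ..
    finally show "tensor G * (emb i (e r) * emb j (e r))
      = adj (emb i (adj (e r)) * emb j (adj (e r))) * tensor G" .
  qed
  also have "\<dots> = adj (mat_sum D (\<lambda>r. emb i (adj (e r)) * emb j (adj (e r))) {..<n\<^sup>2}) * tensor G"
    using ij ec by (subst adj_mat_sum, simp, subst mat_sum_mult[OF G]) (auto intro!: adj_carrier)
  also have "mat_sum D (\<lambda>r. emb i (adj (e r)) * emb j (adj (e r))) {..<n\<^sup>2} = casimir i j"
    unfolding casimir_def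
  proof (rule mat_eqI_carrier[OF mat_sum_carrier mat_sum_carrier])
    fix a b assume ab: "a < D" "b < D"
    have "(\<Sum>r<n\<^sup>2. (emb i (adj (e r)) * emb j (adj (e r))) $$ (a, b)) = (\<Sum>r<n\<^sup>2. (emb i (e r) * emb j (e r)) $$ (a, b))"
      by (rule casimir_adj[OF onb]) (rule linear_functional_emb[OF ij(1,2) _ ab]; assumption)+
    then show "mat_sum D (\<lambda>r. emb i (adj (e r)) * emb j (adj (e r))) {..<n\<^sup>2} $$ (a, b)
        = mat_sum D (\<lambda>r. emb i (e r) * emb j (e r)) {..<n\<^sup>2} $$ (a, b)"
      using ab by (simp del: index_mult_mat(1))
  qed
  finally show ?thesis .
qed

text \<open>Passing the Gram matrix through a word letter by letter collects the adjoints of the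
  same letters; the adjoint is an antihomomorphism, so they assemble to the reversed word.\<close>

lemma tensor_G_diagram_operator:
  assumes "w \<in> chord_diagrams N"
  shows "tensor G * word_op w = adj (word_op (reverse_word w)) * tensor G"
proof -
  note G = tensor_G_carrier
  have "tensor G * word_op (Word cs) = adj (word_op (Word (rev cs))) * tensor G"
    if "set cs \<subseteq> {(i, j). 1 \<le> i \<and> i < j \<and> j \<le> N}" for cs
    using that
  proof (induction cs)
    case Nil
    then show ?case using G by (simp add: diagram_operator_def)
  next
    case (Cons c cs)
    obtain i j where c: "c = (i, j)" "i \<in> {1..N}" "j \<in> {1..N}" "i \<noteq> j"
      using Cons.prems by (cases c) auto
    let ?w = "word_op (Word cs)" and ?w' = "word_op (Word (rev cs))" and ?C = "casimir i j"
    have split: "word_op (Word (c # cs)) = ?C * ?w" "word_op (Word (rev (c # cs))) = ?w' * ?C"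
      using diagram_operator_add[of "Word [c]" "Word cs"] diagram_operator_add[of "Word (rev cs)" "Word [c]"]
        chord_operator_casimir[OF c(2-)] c(1)
      by (simp_all add: plus_free_word_def diagram_operator_def right_mult_one_mat[OF casimir_carrier])
    note car = diagram_operator_carrier[of "Word cs"] diagram_operator_carrier[of "Word (rev cs)"]
    have "tensor G * (?C * ?w) = adj ?C * (tensor G * ?w)"
      unfolding assoc_mult_mat[OF G casimir_carrier car(1), symmetric] tensor_G_casimir[OF c(2-)]
      by (rule assoc_mult_mat[OF adj_carrier[OF casimir_carrier] G car(1)])
    also have "tensor G * ?w = adj ?w' * tensor G" using Cons by simp
    also have "adj ?C * (adj ?w' * tensor G) = adj (?w' * ?C) * tensor G"
      unfolding adj_mult[OF car(2) casimir_carrier]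
      by (rule assoc_mult_mat[OF adj_carrier[OF casimir_carrier] adj_carrier[OF car(2)] G, symmetric])
    finally show ?case by (simp only: split)
  qed
  from this[of "letters w"] assms show ?thesis by (simp add: chord_diagrams_def reverse_word_def)
qed

text \<open>The coefficient of a word is conjugated by \<open>reverse\<close> and again by the
  adjoint, so it agrees on both sides.\<close>

lemma tensor_G_combination_operator:
  assumes "p \<in> carrier (diagram_ring N)"
  shows "tensor G * comb_op p = adj (comb_op (reverse p)) * tensor G"
proof -
  note G = tensor_G_carrier
  let ?l = "Poly_Mapping.lookup p" and ?K = "Poly_Mapping.keys p"
  note car = diagram_operator_carrier
  have "tensor G * comb_op p = mat_sum D (\<lambda>w. tensor G * (?l w \<cdot>\<^sub>m word_op w)) ?K"
    unfolding combination_operator_eq by (rule mult_mat_sum[OF G]) (simp add: car)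
  also have "\<dots> = mat_sum D (\<lambda>w. adj (cnj (?l w) \<cdot>\<^sub>m word_op (reverse_word w)) * tensor G) ?K"
  proof (rule mat_sum_cong)
    fix w assume "w \<in> ?K"
    then have w: "w \<in> chord_diagrams N" using assms by auto
    show "tensor G * (?l w \<cdot>\<^sub>m word_op w) = adj (cnj (?l w) \<cdot>\<^sub>m word_op (reverse_word w)) * tensor G"
      unfolding adj_smult complex_cnj_cnj mult_smult_distrib[OF G car] tensor_G_diagram_operator[OF w]
      by (rule mult_smult_assoc_mat[OF adj_carrier[OF car] G, symmetric])
  qed
  also have "\<dots> = adj (mat_sum D (\<lambda>w. cnj (?l w) \<cdot>\<^sub>m word_op (reverse_word w)) ?K) * tensor G"
    by (subst adj_mat_sum, simp add: car, subst mat_sum_mult[OF G]) (auto simp: car intro!: adj_carrier)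
  also have "mat_sum D (\<lambda>w. cnj (?l w) \<cdot>\<^sub>m word_op (reverse_word w)) ?K = comb_op (reverse p)"
  proof -
    have "inj_on reverse_word ?K" by (rule inj_on_inverseI[of _ reverse_word]) simp
    then show ?thesis
      unfolding combination_operator_eq keys_reverse mat_sum_def
      by (simp add: sum.reindex lookup_reverse)
  qed
  finally show ?thesis .
qed

end

end

section \<open>Invariant inner products on symmetric and exterior powers\<close>

lemma finite_tensor_indices: "finite (tensor_indices n k)"
proof -
  have "tensor_indices n k = {x. set x \<subseteq> {..<n} \<and> length x = k}" by (auto simp: tensor_indices_def)
  then show ?thesis by (simp add: finite_lists_length_eq)
qed

lemma list_update_in_tensor_indices:
  "x \<in> tensor_indices n k \<Longrightarrow> m < n \<Longrightarrow> x[j := m] \<in> tensor_indices n k"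
  using set_update_subset_insert[of x j m] by (auto simp: tensor_indices_def)

lemma nth_in_tensor_indices: "x \<in> tensor_indices n k \<Longrightarrow> j < k \<Longrightarrow> x ! j < n"
  using nth_mem[of j x] by (auto simp: tensor_indices_def simp del: nth_mem)

text \<open>For the standard inner product on components, the adjoint of \<open>A\<close> acting in
  one tensor position is \<open>adj A\<close> acting in the same position; the identity is proved
  position by position and summed.\<close>

lemma tensor_power_action_adj:
  assumes A: "A \<in> carrier_mat n n"
  shows "(\<Sum>x\<in>tensor_indices n k. cnj (s x) * tensor_power_action n k A t x)
    = (\<Sum>x\<in>tensor_indices n k. cnj (tensor_power_action n k (adj A) s x) * t x)"
proof -
  let ?I = "tensor_indices n k"
  have "(\<Sum>x\<in>?I. cnj (s x) * tensor_power_action n k A t x)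
      = (\<Sum>j<k. \<Sum>x\<in>?I. \<Sum>m<n. cnj (s x) * (A $$ (x ! j, m) * t (x[j := m])))"
    by (subst sum.swap) (simp add: tensor_power_action_def sum_distrib_left)
  also have "\<dots> = (\<Sum>j<k. \<Sum>x\<in>?I. \<Sum>m<n. cnj (s (x[j := m])) * (A $$ (m, x ! j) * t x))"
  proof (rule sum.cong[OF refl])
    fix j assume "j \<in> {..<k}"
    then have j: "j < k" by simp
    \<comment> \<open>Exchanging the \<open>j\<close>-th entry of \<open>x\<close> with the
      summation index is an involution, so it is its own inverse in the reindexing.\<close>
    let ?h = "\<lambda>(x :: nat list, m). (x[j := m], x ! j)"
    have len: "length x = k" if "x \<in> ?I" for x using that by (simp add: tensor_indices_def)
    have "(\<Sum>(x, m)\<in>?I \<times> {..<n}. cnj (s x) * (A $$ (x ! j, m) * t (x[j := m])))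
        = (\<Sum>(x, m)\<in>?I \<times> {..<n}. cnj (s (x[j := m])) * (A $$ (m, x ! j) * t x))"
      by (rule sum.reindex_bij_witness[of _ ?h ?h])
        (auto simp: j len list_update_in_tensor_indices nth_in_tensor_indices)
    then show "(\<Sum>x\<in>?I. \<Sum>m<n. cnj (s x) * (A $$ (x ! j, m) * t (x[j := m])))
        = (\<Sum>x\<in>?I. \<Sum>m<n. cnj (s (x[j := m])) * (A $$ (m, x ! j) * t x))"
      by (simp add: sum.cartesian_product)
  qed
  also have "\<dots> = (\<Sum>x\<in>?I. \<Sum>j<k. \<Sum>m<n. cnj (s (x[j := m])) * (A $$ (m, x ! j) * t x))"
    by (rule sum.swap)
  also have "\<dots> = (\<Sum>x\<in>?I. cnj (tensor_power_action n k (adj A) s x) * t x)"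
  proof (rule sum.cong[OF refl])
    fix x assume x: "x \<in> ?I"
    have "adj A $$ (x ! j, m) = cnj (A $$ (m, x ! j))" if "j < k" "m < n" for j m
      using A that nth_in_tensor_indices[OF x that(1)] by auto
    then show "(\<Sum>j<k. \<Sum>m<n. cnj (s (x[j := m])) * (A $$ (m, x ! j) * t x))
        = cnj (tensor_power_action n k (adj A) s x) * t x"
      using x by (simp add: tensor_power_action_def cnj_sum sum_distrib_left sum_distrib_right mult_ac)
  qed
  finally show ?thesis .
qed

text \<open>If \<open>adj F * F\<close> kills \<open>v\<close>, then the squared norm of
  \<open>F *\<^sub>v v\<close> vanishes, so \<open>v\<close> is zero by injectivity; a square matrix
  with trivial kernel is invertible.\<close>

lemma ex_inverse_gram_matrix:
  assumes F: "F \<in> carrier_mat m d"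
    and inj: "\<And>v. v \<in> carrier_vec d \<Longrightarrow> F *\<^sub>v v = 0\<^sub>v m \<Longrightarrow> v = 0\<^sub>v d"
  shows "\<exists>H\<in>carrier_mat d d. adj F * F * H = 1\<^sub>m d \<and> H * (adj F * F) = 1\<^sub>m d"
proof -
  have G: "adj F * F \<in> carrier_mat d d" by (rule mult_carrier_mat[OF adj_carrier[OF F] F])
  have "v = 0\<^sub>v d" if v: "v \<in> carrier_vec d" "adj F * F *\<^sub>v v = 0\<^sub>v d" for v
  proof (rule inj[OF v(1)])
    let ?w = "F *\<^sub>v v"
    have w: "?w \<in> carrier_vec m" by (rule mult_mat_vec_carrier[OF F v(1)])
    have aw: "adj F *\<^sub>v ?w = 0\<^sub>v d" using assoc_mult_mat_vec[OF adj_carrier[OF F] F v(1)] v(2) by simp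
    have aw_index: "(\<Sum>a<m. cnj (F $$ (a, b)) * ?w $ a) = 0" if "b < d" for b
    proof -
      have "(adj F *\<^sub>v ?w) $ b = (\<Sum>a<m. adj F $$ (b, a) * ?w $ a)"
        using F w that by (auto simp: scalar_prod_def lessThan_atLeast0)
      moreover have "\<dots> = (\<Sum>a<m. cnj (F $$ (a, b)) * ?w $ a)"
        using F that by (intro sum.cong refl) auto
      ultimately show ?thesis using aw that by simp
    qed
    have w_index: "?w $ a = (\<Sum>b<d. F $$ (a, b) * v $ b)" if "a < m" for a
      using F v that by (auto simp: scalar_prod_def lessThan_atLeast0)
    \<comment> \<open>The squared norm of \<open>?w\<close> is rewritten as the pairing of
      \<open>v\<close> with \<open>adj F\<close> applied to \<open>?w\<close>, which is
      zero.\<close>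
    have "complex_of_real (\<Sum>a<m. (cmod (?w $ a))\<^sup>2) = (\<Sum>a<m. cnj (?w $ a) * ?w $ a)"
      by (simp only: of_real_sum complex_norm_square mult.commute)
    also have "\<dots> = (\<Sum>a<m. \<Sum>b<d. cnj (v $ b) * (cnj (F $$ (a, b)) * ?w $ a))"
    proof (rule sum.cong[OF refl])
      fix a assume "a \<in> {..<m}"
      then have "cnj (?w $ a) = (\<Sum>b<d. cnj (F $$ (a, b)) * cnj (v $ b))"
        using w_index[of a] by (simp add: cnj_sum)
      then show "cnj (?w $ a) * ?w $ a = (\<Sum>b<d. cnj (v $ b) * (cnj (F $$ (a, b)) * ?w $ a))"
        by (simp add: sum_distrib_left sum_distrib_right mult_ac)
    qed
    also have "\<dots> = (\<Sum>b<d. cnj (v $ b) * (\<Sum>a<m. cnj (F $$ (a, b)) * ?w $ a))"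
      by (subst sum.swap) (simp add: sum_distrib_left)
    also have "\<dots> = 0" using aw_index by simp
    finally have "(\<Sum>a<m. (cmod (?w $ a))\<^sup>2) = 0" using of_real_eq_0_iff by blast
    then have "\<forall>a\<in>{..<m}. (cmod (?w $ a))\<^sup>2 = 0" by (subst (asm) sum_nonneg_eq_0_iff) auto
    then show "?w = 0\<^sub>v m" using w F by (intro eq_vecI) auto
  qed
  then have "det (adj F * F) \<noteq> 0" using det_0_iff_vec_prod_zero[OF G] by blast
  from det_non_zero_imp_unit[OF G this, of "()"] show ?thesis
    by (auto simp: Units_def ring_mat_simps)
qed

text \<open>\<open>F\<close> is the matrix of the isomorphism onto \<open>V\<close>, with rows
  indexed by an enumeration \<open>xs\<close> of the tensor indices, and \<open>adj F * F\<close> is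
  the pullback of the standard inner product. Leaving \<open>V\<close> general lets the symmetric
  and exterior cases share one argument.\<close>

lemma ex_invariant_gram_matrix:
  assumes iso: "isomorphic_to_subrep n k V d \<rho>" and V: "V \<subseteq> tensor_power n k"
    and rep: "gl_rep n d \<rho>"
  shows "\<exists>m F H. F \<in> carrier_mat m d \<and> H \<in> carrier_mat d d \<and> adj F * F * H = 1\<^sub>m d
    \<and> H * (adj F * F) = 1\<^sub>m d \<and> (\<forall>A\<in>carrier_mat n n. adj F * F * \<rho> A = adj (\<rho> (adj A)) * (adj F * F))"
proof -
  let ?I = "tensor_indices n k"
  obtain f where bij: "bij_betw f (carrier_vec d) V"
    and f_add: "\<And>v w. v \<in> carrier_vec d \<Longrightarrow> w \<in> carrier_vec d \<Longrightarrow> f (v + w) = (\<lambda>x. f v x + f w x)"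
    and f_smult: "\<And>c v. v \<in> carrier_vec d \<Longrightarrow> f (c \<cdot>\<^sub>v v) = (\<lambda>x. c * f v x)"
    and f_act: "\<And>A v. A \<in> carrier_mat n n \<Longrightarrow> v \<in> carrier_vec d
      \<Longrightarrow> f (\<rho> A *\<^sub>v v) = tensor_power_action n k A (f v)"
    using iso unfolding isomorphic_to_subrep_def by blast
  have rep_carrier: "\<rho> A \<in> carrier_mat d d" if "A \<in> carrier_mat n n" for A
    using rep that by (simp add: gl_rep_def)
  obtain xs where xs: "set xs = ?I" "distinct xs"
    using finite_distinct_list[OF finite_tensor_indices] by blast
  define m where "m = length xs"
  define F where "F = mat m d (\<lambda>(a, b). f (unit_vec d b) (xs ! a))"
  have F: "F \<in> carrier_mat m d" by (simp add: F_def)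
  have f_zero: "f (0\<^sub>v d) = (\<lambda>x. 0)"
  proof -
    have "0 \<cdot>\<^sub>v 0\<^sub>v d = (0\<^sub>v d :: complex vec)" by (intro eq_vecI) auto
    then show ?thesis using f_smult[of "0\<^sub>v d" 0] by simp
  qed
  \<comment> \<open>Only binary sums and scalar multiples are known to be respected by
    \<open>f\<close>, so the expansion is built up over the truncations of \<open>v\<close> to its
    first \<open>j\<close> entries.\<close>
  have f_expand: "f v x = (\<Sum>b<d. v $ b * f (unit_vec d b) x)" if v: "v \<in> carrier_vec d" for v x
  proof -
    have "f (vec d (\<lambda>b. if b < j then v $ b else 0)) x = (\<Sum>b<j. v $ b * f (unit_vec d b) x)"
      if "j \<le> d" for j using that
    proof (induction j)
      case 0
      have "vec d (\<lambda>b. if b < 0 then v $ b else 0) = 0\<^sub>v d" by (intro eq_vecI) auto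
      then show ?case using f_zero by simp
    next
      case (Suc j)
      have "vec d (\<lambda>b. if b < Suc j then v $ b else 0)
          = vec d (\<lambda>b. if b < j then v $ b else 0) + v $ j \<cdot>\<^sub>v unit_vec d j"
        using Suc.prems by (intro eq_vecI) (auto simp: less_Suc_eq)
      then show ?case using Suc by (simp add: f_add f_smult)
    qed
    from this[of d] have "f (vec d (\<lambda>b. if b < d then v $ b else 0)) x = (\<Sum>b<d. v $ b * f (unit_vec d b) x)"
      by simp
    moreover have "vec d (\<lambda>b. if b < d then v $ b else 0) = v" using v by (intro eq_vecI) auto
    ultimately show ?thesis by simp
  qed
  have F_vec: "(F *\<^sub>v v) $ a = f v (xs ! a)" if "v \<in> carrier_vec d" "a < m" for v a
    using that by (simp add: F_def scalar_prod_def lessThan_atLeast0 f_expand[OF that(1)] mult.commute)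
  have "v = 0\<^sub>v d" if v: "v \<in> carrier_vec d" "F *\<^sub>v v = 0\<^sub>v m" for v
  proof -
    \<comment> \<open>The rows of \<open>F\<close> see only the tensor indices; elsewhere
      \<open>f v\<close> vanishes because \<open>V\<close> lies in
      \<open>tensor_power n k\<close>.\<close>
    have "f v x = 0" for x
    proof (cases "x \<in> ?I")
      case True
      then obtain a where "a < m" "xs ! a = x" using xs(1) by (metis in_set_conv_nth m_def)
      then show ?thesis using F_vec[OF v(1)] v(2) by force
    next
      case False
      have "f v \<in> V" using bij v(1) by (auto simp: bij_betw_def)
      then show ?thesis using V False by (auto simp: tensor_power_def)
    qed
    then have "f v = f (0\<^sub>v d)" using f_zero by auto
    then show ?thesis using bij v(1) by (auto simp: bij_betw_def inj_on_def)
  qed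
  from ex_inverse_gram_matrix[OF F this]
  obtain H where H: "H \<in> carrier_mat d d" "adj F * F * H = 1\<^sub>m d" "H * (adj F * F) = 1\<^sub>m d" by blast
  have "adj F * F * \<rho> A = adj (\<rho> (adj A)) * (adj F * F)" if A: "A \<in> carrier_mat n n" for A
  proof -
    note adjF = adj_carrier[OF F] and \<rho>A = rep_carrier[OF A]
      and \<rho>A' = rep_carrier[OF adj_carrier[OF A]]
    \<comment> \<open>Column \<open>b\<close> of \<open>F * \<rho> B\<close> lists the components of
      \<open>f\<close> at the image of a unit vector under \<open>\<rho> B\<close>; equivariance of
      \<open>f\<close> turns this into the action on the tensor power.\<close>
    have F\<rho>: "(F * \<rho> B) $$ (a, b) = tensor_power_action n k B (f (unit_vec d b)) (xs ! a)"
      if B: "B \<in> carrier_mat n n" and ab: "a < m" "b < d" for B a b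
    proof -
      have "(F * \<rho> B) $$ (a, b) = (F *\<^sub>v col (\<rho> B) b) $ a" using F rep_carrier[OF B] ab by simp
      also have "col (\<rho> B) b = \<rho> B *\<^sub>v unit_vec d b"
        using rep_carrier[OF B] ab(2) by (intro eq_vecI) auto
      also have "(F *\<^sub>v \<dots>) $ a = tensor_power_action n k B (f (unit_vec d b)) (xs ! a)"
        using F_vec[of "\<rho> B *\<^sub>v unit_vec d b" a] rep_carrier[OF B] ab f_act[OF B, of "unit_vec d b"] by simp
      finally show ?thesis .
    qed
    have to_sum: "(\<Sum>a<m. g (xs ! a)) = (\<Sum>x\<in>?I. g x)" for g :: "nat list \<Rightarrow> complex"
      using bij_betw_nth[OF xs(2), of "{..<m}" ?I] by (intro sum.reindex_bij_betw) (auto simp: m_def xs(1))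
    have F\<rho>A: "F * \<rho> A \<in> carrier_mat m d" by (rule mult_carrier_mat[OF F \<rho>A])
    have F\<rho>A': "F * \<rho> (adj A) \<in> carrier_mat m d" by (rule mult_carrier_mat[OF F \<rho>A'])
    have "adj F * (F * \<rho> A) = adj (F * \<rho> (adj A)) * F"
    proof (rule mat_eqI_carrier[OF mult_carrier_mat[OF adjF F\<rho>A] mult_carrier_mat[OF adj_carrier[OF F\<rho>A'] F]])
      fix a b assume ab: "a < d" "b < d"
      have "(adj F * (F * \<rho> A)) $$ (a, b) = (\<Sum>i<m. cnj (f (unit_vec d a) (xs ! i))
          * tensor_power_action n k A (f (unit_vec d b)) (xs ! i))"
        unfolding mult_index_sum[OF adjF F\<rho>A ab] using ab F\<rho>[OF A] by (auto simp: F_def)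
      also have "\<dots> = (\<Sum>i<m. cnj (tensor_power_action n k (adj A) (f (unit_vec d a)) (xs ! i))
          * f (unit_vec d b) (xs ! i))"
        unfolding to_sum[of "\<lambda>x. cnj (f (unit_vec d a) x) * tensor_power_action n k A (f (unit_vec d b)) x"]
          to_sum[of "\<lambda>x. cnj (tensor_power_action n k (adj A) (f (unit_vec d a)) x) * f (unit_vec d b) x"]
        by (rule tensor_power_action_adj[OF A])
      also have "\<dots> = (adj (F * \<rho> (adj A)) * F) $$ (a, b)"
      proof -
        have "adj (F * \<rho> (adj A)) $$ (a, i) = cnj ((F * \<rho> (adj A)) $$ (i, a))" if "i < m" for i
          by (rule adj_index[OF F\<rho>A' ab(1) that])
        then show ?thesis
          unfolding mult_index_sum[OF adj_carrier[OF F\<rho>A'] F ab]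
          using ab F\<rho>[OF adj_carrier[OF A] _ ab(1)] by (auto simp: F_def)
      qed
      finally show "(adj F * (F * \<rho> A)) $$ (a, b) = (adj (F * \<rho> (adj A)) * F) $$ (a, b)" .
    qed
    then show ?thesis
      unfolding assoc_mult_mat[OF adjF F \<rho>A] adj_mult[OF F \<rho>A']
      by (simp only: assoc_mult_mat[OF adj_carrier[OF \<rho>A'] adjF F])
  qed
  then show ?thesis using F H by blast
qed

section \<open>Symmetric and exterior powers in the allowed range are nonzero\<close>

lemma permute_list_in_tensor_indices:
  "\<sigma> permutes {..<k} \<Longrightarrow> x \<in> tensor_indices n k \<Longrightarrow> permute_list \<sigma> x \<in> tensor_indices n k"
  by (auto simp: tensor_indices_def)

text \<open>The witness is the \<open>k\<close>-th tensor power of the sum of the standard basis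
  vectors, all of whose components are 1; \<open>n \<ge> 1\<close> makes the list of zeros an
  index.\<close>

lemma symmetric_tensors_nontrivial:
  assumes "n \<ge> 1"
  shows "\<exists>t\<in>symmetric_tensors n k. t \<noteq> (\<lambda>x. 0)"
proof
  let ?t = "\<lambda>x. if x \<in> tensor_indices n k then 1 else 0 :: complex"
  show "?t \<in> symmetric_tensors n k"
    by (auto simp: symmetric_tensors_def tensor_power_def permute_list_in_tensor_indices)
  have "?t (replicate k 0) = 1" using assms by (auto simp: tensor_indices_def)
  then show "?t \<noteq> (\<lambda>x. 0)" by (metis zero_neq_one)
qed

text \<open>The witness is the wedge of the first \<open>k\<close> standard basis vectors. Its
  component at \<open>x\<close> is the determinant of the matrix with a 1 in row \<open>i\<close>
  and column \<open>x ! i\<close>, a row with \<open>x ! i \<ge> k\<close> being zero. Permuting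
  \<open>x\<close> permutes the rows, which gives the sign; \<open>k \<le> n\<close> makes
  \<open>[0..<k]\<close> an index, with component 1.\<close>

lemma antisymmetric_tensors_nontrivial:
  assumes "k \<le> n"
  shows "\<exists>t\<in>antisymmetric_tensors n k. t \<noteq> (\<lambda>x. 0)"
proof
  let ?M = "\<lambda>x :: nat list. mat k k (\<lambda>(i, j). if x ! i = j then 1 else 0 :: complex)"
  let ?t = "\<lambda>x. if x \<in> tensor_indices n k then det (?M x) else 0"
  have "det (?M (permute_list \<sigma> x)) = of_int (sign \<sigma>) * det (?M x)"
    if \<sigma>: "\<sigma> permutes {..<k}" and x: "x \<in> tensor_indices n k" for \<sigma> x
  proof -
    have "?M (permute_list \<sigma> x) = mat k k (\<lambda>(i, j). ?M x $$ (\<sigma> i, j))"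
      using x \<sigma> permutes_in_image[OF \<sigma>]
      by (intro eq_matI) (auto simp: tensor_indices_def permute_list_nth)
    also have "det \<dots> = of_int (sign \<sigma>) * det (?M x)"
      using det_permute_rows[of "?M x" k \<sigma>] \<sigma> by (simp add: lessThan_atLeast0)
    finally show ?thesis .
  qed
  then show "?t \<in> antisymmetric_tensors n k"
    by (auto simp: antisymmetric_tensors_def tensor_power_def permute_list_in_tensor_indices)
  have "?M [0..<k] = 1\<^sub>m k" by (intro eq_matI) auto
  moreover have "[0..<k] \<in> tensor_indices n k" using assms by (auto simp: tensor_indices_def)
  ultimately have one: "?t [0..<k] = 1" by simp
  show "?t \<noteq> (\<lambda>x. 0)"
  proof
    assume "?t = (\<lambda>x. 0)"
    from fun_cong[OF this, of "[0..<k]"] show False unfolding one by simp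
  qed
qed

text \<open>In dimension zero the bijection would make \<open>V\<close> a singleton, but it contains
  the zero tensor and another one.\<close>

lemma isomorphic_to_subrep_dim_pos:
  assumes "isomorphic_to_subrep n k V d \<rho>" "(\<lambda>x. 0) \<in> V" "\<exists>t\<in>V. t \<noteq> (\<lambda>x. 0)"
  shows "0 < d"
proof (rule ccontr)
  assume "\<not> 0 < d"
  then have "carrier_vec d = {0\<^sub>v d :: complex vec}" by auto
  moreover obtain f where "bij_betw f (carrier_vec d :: complex vec set) V"
    using assms(1) unfolding isomorphic_to_subrep_def by blast
  ultimately have "V = {f (0\<^sub>v d)}" by (auto simp: bij_betw_def)
  then show False using assms(2,3) by auto
qed

section \<open>Linearity, positivity and normalization of the weight system\<close>

theorem theorem1:
  fixes n N :: nat
    and e :: "nat \<Rightarrow> complex mat"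
    and k d :: "nat \<Rightarrow> nat"
    and \<rho> :: "nat \<Rightarrow> complex mat \<Rightarrow> complex mat"
  assumes "n \<ge> 1" and "N \<ge> 1"
    and "gl_orthonormal_basis n e"
    and "\<And>i. i \<in> {1..N} \<Longrightarrow>
      (1 \<le> k i \<and> is_symmetric_power n (k i) (d i) (\<rho> i)) \<or>
      (1 \<le> k i \<and> k i \<le> n \<and> is_exterior_power n (k i) (d i) (\<rho> i))"
  shows "quantum_state (hcd_algebra N) (weight_system n N e d \<rho>)"
proof -
  have rep: "gl_rep n (d i) (\<rho> i)" if "i \<in> {1..N}" for i
    using assms(4)[OF that] by (auto simp: is_symmetric_power_def is_exterior_power_def)
  interpret gl_strands n N e d \<rho> by unfold_locales (fact assms(3), fact rep)
  \<comment> \<open>The two kinds of representation merge here: what follows uses only an embedding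
    into a tensor power, for the inner product, and a nonzero tensor, for the dimension.\<close>
  have sub: "\<exists>V. isomorphic_to_subrep n (k i) V (d i) (\<rho> i) \<and> V \<subseteq> tensor_power n (k i)
      \<and> (\<lambda>x. 0) \<in> V \<and> (\<exists>t\<in>V. t \<noteq> (\<lambda>x. 0))" if "i \<in> {1..N}" for i
    using assms(4)[OF that]
  proof
    assume "1 \<le> k i \<and> is_symmetric_power n (k i) (d i) (\<rho> i)"
    then show ?thesis using symmetric_tensors_nontrivial[OF assms(1)]
      by (intro exI[of _ "symmetric_tensors n (k i)"])
        (auto simp: is_symmetric_power_def symmetric_tensors_def tensor_power_def)
  next
    assume "1 \<le> k i \<and> k i \<le> n \<and> is_exterior_power n (k i) (d i) (\<rho> i)"
    then show ?thesis using antisymmetric_tensors_nontrivial[of "k i" n]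
      by (intro exI[of _ "antisymmetric_tensors n (k i)"])
        (auto simp: is_exterior_power_def antisymmetric_tensors_def tensor_power_def)
  qed
  have d_pos: "0 < d i" if "i \<in> {1..N}" for i
    using sub[OF that] isomorphic_to_subrep_dim_pos by blast
  have "\<forall>i\<in>{1..N}. \<exists>m F H. F \<in> carrier_mat m (d i) \<and> H \<in> carrier_mat (d i) (d i) \<and> adj F * F * H = 1\<^sub>m (d i)
    \<and> H * (adj F * F) = 1\<^sub>m (d i) \<and> (\<forall>A\<in>carrier_mat n n. adj F * F * \<rho> i A = adj (\<rho> i (adj A)) * (adj F * F))"
    using sub ex_invariant_gram_matrix rep by meson
  then obtain m F H where F: "\<And>i. i \<in> {1..N} \<Longrightarrow> F i \<in> carrier_mat (m i) (d i)"
    and H: "\<And>i. i \<in> {1..N} \<Longrightarrow> H i \<in> carrier_mat (d i) (d i)"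
      "\<And>i. i \<in> {1..N} \<Longrightarrow> adj (F i) * F i * H i = 1\<^sub>m (d i)"
      "\<And>i. i \<in> {1..N} \<Longrightarrow> H i * (adj (F i) * F i) = 1\<^sub>m (d i)"
    and G_adj: "\<And>i A. i \<in> {1..N} \<Longrightarrow> A \<in> carrier_mat n n
      \<Longrightarrow> adj (F i) * F i * \<rho> i A = adj (\<rho> i (adj A)) * (adj (F i) * F i)"
    by metis
  define G where "G i = adj (F i) * F i" for i
  have G: "G i \<in> carrier_mat (d i) (d i)" if "i \<in> {1..N}" for i
    unfolding G_def by (rule mult_carrier_mat[OF adj_carrier[OF F[OF that]] F[OF that]])
  \<comment> \<open>The Kronecker product of the strand embeddings has Gram matrix
    \<open>tensor G\<close>, so it supplies the factorization that the trace argument needs on the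
    whole tensor product.\<close>
  have TF: "tensor F \<in> carrier_mat (prod_list (map m [1..<N + 1])) D"
    unfolding D_eq by (intro tensor_mats_carrier F) auto
  have TG: "tensor G = adj (tensor F) * tensor F"
    unfolding adj_tensor_mats G_def
    by (rule tensor_mats_mult[symmetric, where r = d and c = m and s = d]) (auto intro!: adj_carrier F)
  have TH: "tensor H \<in> carrier_mat D D" by (rule tensor_carrier[OF H(1)])
  have one: "tensor (\<lambda>i. 1\<^sub>m (d i)) = 1\<^sub>m D" unfolding D_eq by (rule tensor_mats_one)
  have "tensor G * tensor H = tensor (\<lambda>i. G i * H i)" by (rule tensor_mult[OF G H(1)])
  also have "\<dots> = 1\<^sub>m D"
    unfolding one[symmetric] by (intro arg_cong[of _ _ tensor_mats] map_cong) (auto simp: G_def H)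
  finally have TGH: "tensor G * tensor H = 1\<^sub>m D" .
  have "tensor H * tensor G = tensor (\<lambda>i. H i * G i)" by (rule tensor_mult[OF H(1) G])
  also have "\<dots> = 1\<^sub>m D"
    unfolding one[symmetric] by (intro arg_cong[of _ _ tensor_mats] map_cong) (auto simp: G_def H)
  finally have THG: "tensor H * tensor G = 1\<^sub>m D" .
  \<comment> \<open>The general identity is applied to \<open>reverse p\<close>, so that the double
    reversal leaves \<open>p\<close> on the right; in this form \<open>comb_op (reverse p)\<close>
    is the adjoint of \<open>comb_op p\<close>.\<close>
  have adjoint: "tensor G * comb_op (reverse p) = adj (comb_op p) * tensor G"
    if "p \<in> carrier (diagram_ring N)" for p
    using tensor_G_combination_operator[of G "reverse p"] G G_adj reverse_in_diagram_ring[OF that]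
    by (simp add: G_def reverse_reverse)
  have W: "weight_system n N e d \<rho> (braid_coset N p) = mat_trace (comb_op p)" for p
    by (simp add: weight_system_def operator_weight_system_coset)
  note car = combination_operator_carrier
  show ?thesis
  proof (intro quantum_state.intro complex_star_algebra_hcd_algebra quantum_state_axioms.intro)
    fix X Y z w assume "X \<in> carrier (hcd_algebra N)" "Y \<in> carrier (hcd_algebra N)"
    then obtain p q where "p \<in> carrier (diagram_ring N)" "q \<in> carrier (diagram_ring N)"
      "X = braid_coset N p" "Y = braid_coset N q"
      unfolding carrier_hcd_algebra by blast
    then show "weight_system n N e d \<rho> (z \<odot>\<^bsub>hcd_algebra N\<^esub> X \<oplus>\<^bsub>hcd_algebra N\<^esub> w \<odot>\<^bsub>hcd_algebra N\<^esub> Y)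
        = z * weight_system n N e d \<rho> X + w * weight_system n N e d \<rho> Y"
      by (simp add: smult_hcd_algebra add_hcd_algebra scale_in_diagram_ring W combination_operator_add
          combination_operator_scale mat_trace_add[OF smult_carrier_mat[OF car] smult_carrier_mat[OF car]]
          mat_trace_smult[OF car] del: diagram_ring_simps)
  next
    fix X assume "X \<in> carrier (hcd_algebra N)"
    then obtain p where p: "p \<in> carrier (diagram_ring N)" "X = braid_coset N p"
      unfolding carrier_hcd_algebra by blast
    then have "weight_system n N e d \<rho> (X \<otimes>\<^bsub>hcd_algebra N\<^esub> \<star>\<^bsub>hcd_algebra N\<^esub> X)
        = mat_trace (comb_op p * comb_op (reverse p))"
      by (simp add: star_hcd_algebra mult_hcd_algebra reverse_in_diagram_ring W combination_operator_mult
          del: diagram_ring_simps)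
    then show "weight_system n N e d \<rho> (X \<otimes>\<^bsub>hcd_algebra N\<^esub> \<star>\<^bsub>hcd_algebra N\<^esub> X) \<in> \<real>
        \<and> 0 \<le> Re (weight_system n N e d \<rho> (X \<otimes>\<^bsub>hcd_algebra N\<^esub> \<star>\<^bsub>hcd_algebra N\<^esub> X))"
      using mat_trace_mult_adjoint_nonneg[OF TF TG TH TGH THG car car adjoint[OF p(1)]] by simp
  next
    \<comment> \<open>The weight of the unit is the trace of the identity, that is, the dimension
      \<open>D\<close> of the tensor product.\<close>
    have "0 < D" unfolding tensor_dim_def using d_pos by (intro prod_pos) auto
    then show "weight_system n N e d \<rho> \<one>\<^bsub>hcd_algebra N\<^esub> \<in> \<real>
        \<and> 0 < Re (weight_system n N e d \<rho> \<one>\<^bsub>hcd_algebra N\<^esub>)"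
      by (simp add: one_hcd_algebra W combination_operator_one mat_trace_def)
  qed
qed

end
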